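(* Let $a\ge 1$ and $0<b<1$, let $\mathbf{P}$ be the Penthouse with parameters $(a,b)$, i.e. the convex pentagon with vertices $A=(0,1)$, $B=(0,0)$, $C=(1,0)$, $D=(1,1)$, $E=(b,1+a)$, and let $T$ be its symplectic billiard map on the phase space $\Phi_{\mathbf{P}}$. (1) If the Penthouse is tall, that is $a>1$, then all orbits are periodic with periods $12$, $20$ and $28$. The structure of the orbits of periodic tiles is as follows: (i) one orbit consisting of tiles that return to themselves after $3$ iterations, with the return map having order $4$; (ii) one orbit consisting of tiles that return to themselves after $10$ iterations, with the return map having order $2$; (iii) one orbit consisting of tiles that return to themselves after $20$ iterations, with the return map being the identity; (iv) one orbit consisting of tiles that return to themselves after $7$ iterations, with the return map having order $4$; (v) two orbits consisting of tiles that return to themselves after $28$ iterations, with the return map being the identity. (2) In the first bifurcation case, when the modulus $m=\lfloor (a+1)/a\rfloor$ changes value from $1$ to $2$, i.e. for $a=1$, the billiard map is fully periodic with one period, namely $28$. There are, however, three different types of symbolic orbits. (This is consistent with the conjecture that all orbits in a Penthouse with $(a+1)/a\notin\mathbb{Z}$ are periodic with periods $16m-4$, $16m+4$, $16m+12$, and that under the bifurcation $m\mapsto m+1$ the tiles with the largest period $16m+12$ survive and become the tiles with the smallest period $16(m+1)-4$, the tiles with periods $16m-4$ and $16m+4$ die, and tiles with periods $16m+20$ and $16m+28$ are born.)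
   Context: Symplectic billiard. Let $\mathbf{P}$ be a convex polygon with vertices $P_1,\dots,P_n$ in counterclockwise order, and $v_i=P_{i+1}-P_i$ (indices cyclic). Write $[\cdot,\cdot]$ for the determinant of two plane vectors and $v_i\times v_j$ for the set of oriented chords $(x,y)$ with tail $x$ in the interior of side $P_iP_{i+1}$ and head $y$ in the interior of side $P_jP_{j+1}$. The symplectic billiard map is $T(x,y)=(y,z)$, where $z\neq x$ is the second intersection point with the boundary of $\mathbf{P}$ of the line through $x$ parallel to the side containing $y$. Iteration is undefined once the head is a vertex of $\mathbf{P}$. The (reduced) phase space $\Phi_{\mathbf{P}}$ is the union of the sets $v_i\times v_j$ with $[v_i,v_j]>0$ (in particular $v_i,v_j$ are not parallel). Area form: on $v_i\times v_j$, with arc-length coordinates $x,y$ on the two sides, the area form is $\sin\alpha\,dx\wedge dy$, where $\alpha$ is the angle between $v_i$ and $v_j$. "All orbits" refers to phase points all of whose forward and backward iterates under $T$ are defined. A point $p$ has period $k$ if $T^k(p)=p$ (not necessarily the minimal period; for instance, the center of a tile may have a smaller period). The symbolic orbit of a phase point is the bi-infinite sequence of labels of the sides visited by its orbit. A tile is the set of all phase points with the same periodic symbolic orbit; the tiles considered here have positive area. $T$ maps tiles to tiles, so one can speak of the orbit of a tile; "returns to itself after $k$ iterations" means $k\ge1$ is least with $T^k(M)=M$, and the return map of $M$ is $T^k|_M$; its order is the least $r\ge1$ with $(T^k|_M)^r=\mathrm{id}$. The Penthouse is a unit square with a triangle placed on top; $a>0$ is the elevation of the roof vertex $E$ above the line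 $AD$, and $b\in(0,1)$ is the distance from $A$ to the foot of the perpendicular from $E$ to $AD$. Its modulus is $m=\lfloor (a+1)/a\rfloor$.
   Formalization: The counts in (ii), (iv), (v) and "three different types of symbolic orbits" are claimed only for b ≠ 1/2; at b = 1/2 they fail (for a>1 no orbits of types (ii), (iv) and only one of type (v); for a=1 only one symbolic type). *)

theory Defs
  imports "HOL-Analysis.Analysis"
begin

type_synonym point = "real \<times> real"
type_synonym chord = "point \<times> point"  \<comment> \<open>oriented chord (tail, head)\<close>

text \<open>Determinant of two plane vectors.\<close>
definition bracket :: "point \<Rightarrow> point \<Rightarrow> real"
  where "bracket u v = fst u * snd v - snd u * fst v"

section \<open>Polygons\<close>

text \<open>A polygon is the list of its vertices in counterclockwise order. Vertices and sides are
  labelled by \<open>0, \<dots>, length V - 1\<close>; side \<open>i\<close> runs from vertex \<open>i\<close> to its cyclic successor.\<close>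

definition next_vertex :: "point list \<Rightarrow> nat \<Rightarrow> point"
  where "next_vertex V i = V ! (Suc i mod length V)"

definition side_vec :: "point list \<Rightarrow> nat \<Rightarrow> point"
  where "side_vec V i = next_vertex V i - V ! i"

definition side_interior :: "point list \<Rightarrow> nat \<Rightarrow> point set"
  where "side_interior V i = open_segment (V ! i) (next_vertex V i)"

definition boundary :: "point list \<Rightarrow> point set"
  where "boundary V = (\<Union>i<length V. closed_segment (V ! i) (next_vertex V i))"

section \<open>The symplectic billiard map\<close>

definition phase_space :: "point list \<Rightarrow> chord set"
  where "phase_space V =
    (\<Union>i<length V. \<Union>j\<in>{j. j < length V \<and> 0 < bracket (side_vec V i) (side_vec V j)}.
       side_interior V i \<times> side_interior V j)"

text \<open>The value is meaningful on \<open>phase_space V\<close> only, where the side containing the head \<open>y\<close>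
  and the second intersection point \<open>z\<close> are unique. If \<open>z\<close> is a vertex then \<open>(y, z)\<close> lies outside
  \<open>phase_space V\<close>; that iteration stops there is expressed by requiring all points of an orbit to
  be in \<open>phase_space V\<close>.\<close>
definition billiard_map :: "point list \<Rightarrow> chord \<Rightarrow> chord"
  where "billiard_map V = (\<lambda>(x, y).
    (y, THE z. z \<in> boundary V \<and> z \<noteq> x \<and>
        (\<exists>j<length V. y \<in> side_interior V j \<and> bracket (z - x) (side_vec V j) = 0)))"

text \<open>Orbits all of whose forward and backward iterates are defined.\<close>
definition is_orbit :: "point list \<Rightarrow> (int \<Rightarrow> chord) \<Rightarrow> bool"
  where "is_orbit V \<omega> \<longleftrightarrow> (\<forall>k. \<omega> k \<in> phase_space V \<and> billiard_map V (\<omega> k) = \<omega> (k + 1))"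

definition complete_points :: "point list \<Rightarrow> chord set"
  where "complete_points V = {\<omega> 0 | \<omega>. is_orbit V \<omega>}"

definition has_period :: "point list \<Rightarrow> chord \<Rightarrow> nat \<Rightarrow> bool"
  where "has_period V p k \<longleftrightarrow> 1 \<le> k \<and> (billiard_map V ^^ k) p = p"

definition has_least_period :: "point list \<Rightarrow> chord \<Rightarrow> nat \<Rightarrow> bool"
  where "has_least_period V p k \<longleftrightarrow> has_period V p k \<and> (\<forall>j<k. \<not> has_period V p j)"

section \<open>Symbolic orbits and tiles\<close>

text \<open>The orbit through the chord \<open>(x\<^sub>0, x\<^sub>1)\<close> consists of the chords \<open>(x\<^sub>k, x\<^sub>k\<^sub>+\<^sub>1)\<close>, so the sides
  visited are those containing the tails.\<close>
definition symbolic_orbit :: "point list \<Rightarrow> chord \<Rightarrow> (int \<Rightarrow> nat) \<Rightarrow> bool"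
  where "symbolic_orbit V p \<sigma> \<longleftrightarrow>
    (\<exists>\<omega>. is_orbit V \<omega> \<and> \<omega> 0 = p \<and>
         (\<forall>k. \<sigma> k < length V \<and> fst (\<omega> k) \<in> side_interior V (\<sigma> k)))"

text \<open>Types of symbolic orbits: symbolic orbits up to a shift, i.e. up to the choice of the
  starting point on the orbit.\<close>
definition shift_class :: "(int \<Rightarrow> nat) \<Rightarrow> (int \<Rightarrow> nat) set"
  where "shift_class \<sigma> = {\<lambda>k. \<sigma> (k + d) | d. True}"

definition symbolic_orbit_types :: "point list \<Rightarrow> (int \<Rightarrow> nat) set set"
  where "symbolic_orbit_types V = {shift_class \<sigma> | \<sigma>. \<exists>p. symbolic_orbit V p \<sigma>}"

definition vec_angle :: "point \<Rightarrow> point \<Rightarrow> real"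
  where "vec_angle u v = arccos (u \<bullet> v / (norm u * norm v))"

definition side_point :: "point list \<Rightarrow> nat \<Rightarrow> real \<Rightarrow> point"
  where "side_point V i s = V ! i + (s / norm (side_vec V i)) *\<^sub>R side_vec V i"

text \<open>Area with respect to \<open>sin \<alpha> dx \<and> dy\<close> in arc-length coordinates on the two sides.\<close>
definition phase_area :: "point list \<Rightarrow> chord set \<Rightarrow> ennreal"
  where "phase_area V M =
    (\<Sum>i<length V. \<Sum>j\<in>{j. j < length V \<and> 0 < bracket (side_vec V i) (side_vec V j)}.
       ennreal (sin (vec_angle (side_vec V i) (side_vec V j))) *
       emeasure lborel {(s, t). 0 < s \<and> s < norm (side_vec V i) \<and>
                                0 < t \<and> t < norm (side_vec V j) \<and>
                                (side_point V i s, side_point V j t) \<in> M})"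

definition tile :: "point list \<Rightarrow> (int \<Rightarrow> nat) \<Rightarrow> chord set"
  where "tile V \<sigma> = {p. symbolic_orbit V p \<sigma>}"

definition tiles :: "point list \<Rightarrow> chord set set"
  where "tiles V = {tile V \<sigma> | \<sigma>. (\<exists>q>0. \<forall>k. \<sigma> (k + q) = \<sigma> k) \<and> 0 < phase_area V (tile V \<sigma>)}"

definition tile_orbit :: "point list \<Rightarrow> chord set \<Rightarrow> chord set set"
  where "tile_orbit V M = {(billiard_map V ^^ k) ` M | k. True}"

definition tile_orbits :: "point list \<Rightarrow> chord set set set"
  where "tile_orbits V = tile_orbit V ` tiles V"

definition has_return_time :: "point list \<Rightarrow> chord set \<Rightarrow> nat \<Rightarrow> bool"
  where "has_return_time V M k \<longleftrightarrow>
    1 \<le> k \<and> (billiard_map V ^^ k) ` M = M \<and> (\<forall>j\<in>{1..<k}. (billiard_map V ^^ j) ` M \<noteq> M)"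

text \<open>\<open>r\<close> is the order of the \<open>k\<close>-th iterate of the billiard map, restricted to \<open>M\<close>.\<close>
definition has_order_on :: "point list \<Rightarrow> chord set \<Rightarrow> nat \<Rightarrow> nat \<Rightarrow> bool"
  where "has_order_on V M k r \<longleftrightarrow>
    1 \<le> r \<and> (\<forall>p\<in>M. ((billiard_map V ^^ k) ^^ r) p = p) \<and>
    (\<forall>j\<in>{1..<r}. \<exists>p\<in>M. ((billiard_map V ^^ k) ^^ j) p \<noteq> p)"

text \<open>Orbits consisting of tiles with return time \<open>k\<close> and return map of order \<open>r\<close>.\<close>
definition tile_orbits_of_type :: "point list \<Rightarrow> nat \<Rightarrow> nat \<Rightarrow> chord set set set"
  where "tile_orbits_of_type V k r =
    {\<O> \<in> tile_orbits V. \<forall>M\<in>\<O>. has_return_time V M k \<and> has_order_on V M k r}"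

section \<open>The Penthouse\<close>

definition penthouse :: "real \<Rightarrow> real \<Rightarrow> point list"
  where "penthouse a b = [(0, 1), (0, 0), (1, 0), (1, 1), (b, 1 + a)]"

definition penthouse_modulus :: "real \<Rightarrow> int"
  where "penthouse_modulus a = \<lfloor>(a + 1) / a\<rfloor>"

end

theory Submission
  imports Defs
begin

text \<open>
  A chord from the right to the left roof side is described by the pair \<open>(r, t)\<close> of the relative
  distances of its end points from \<open>E\<close>. Every complete orbit meets this section, and its first
  return map is \<open>(r, t) \<mapsto> (t, h r)\<close> with the involution \<open>h r = \<delta> - r\<close> for \<open>r < \<delta>\<close> and
  \<open>h r = 1 + \<delta> - r\<close> for \<open>r > \<delta>\<close>, where \<open>\<delta> = 1 / a\<close>. So its fourth power is the identity.
  The itinerary up to the return depends on \<open>r\<close> only: it has length 7 for \<open>r < \<alpha> = b / a\<close> and for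
  \<open>\<alpha> < r < \<delta>\<close> (with different itineraries), and length 3 for \<open>r > \<delta>\<close>. Since \<open>h\<close> preserves
  \<open>{r. r > \<delta>}\<close>, the period is \<open>2 (l + l')\<close> with \<open>l, l' \<in> {3, 7}\<close>, and the symbolic orbit is
  determined by the pairs of itineraries of \<open>(r, h r)\<close> and \<open>(t, h t)\<close>. There are four possible
  pairs (the \<open>kinds\<close>), and up to shifts they combine to six words.
\<close>

section \<open>Convex polygons\<close>

text \<open>The next point depends on the tail and on the side of the head, never on the position of
  the head. Along a fixed itinerary the points of even and of odd index therefore evolve
  independently. All three return words have odd length, so a return exchanges the two parities;
  hence the split form of the section map. Below \<delta> the involution \<open>h\<close> reflects
  about \<delta>/2 and exchanges \<alpha> with \<beta> = \<delta> - \<alpha>. So the itineraries of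
  \<open>r\<close> and \<open>h r\<close> differ near the ends of (0, \<delta>) and agree between
  \<alpha> and \<beta>; this middle range vanishes for b = 1/2, and the range (\<delta>, 1) vanishes
  for a = 1. Counting is then combinatorial: a return sends a pair of kinds
  \<open>(\<kappa>, \<kappa>')\<close> to \<open>(\<kappa>', prod.swap \<kappa>)\<close>, an action
  of the cyclic group of order 4, and the order of a return map is the size of a stabiliser. Two
  obstacles remain. Complete orbits extend into the past while the map is given forwards only; a
  common period makes it invertible on complete points. And two tile orbits share the type (28, 1),
  so they must be separated by their words.\<close>

definition side_at :: "point list \<Rightarrow> nat \<Rightarrow> real \<Rightarrow> point"
  where "side_at V i u = V ! i + u *\<^sub>R side_vec V i"

text \<open>Distance to the line of side \<open>i\<close>, signed and scaled by the length of the
  side; by the counterclockwise order it is nonnegative on the polygon.\<close>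

definition side_dist :: "point list \<Rightarrow> nat \<Rightarrow> point \<Rightarrow> real"
  where "side_dist V i z = bracket (side_vec V i) (z - V ! i)"

definition strictly_convex :: "point list \<Rightarrow> bool"
  where "strictly_convex V \<longleftrightarrow> 3 \<le> length V \<and>
    (\<forall>i<length V. \<forall>k<length V. k \<noteq> i \<and> k \<noteq> Suc i mod length V \<longrightarrow> 0 < side_dist V i (V ! k))"

lemma bracket_simps:
  "bracket (u + v) w = bracket u w + bracket v w"
  "bracket (u - v) w = bracket u w - bracket v w"
  "bracket u (v + w) = bracket u v + bracket u w"
  "bracket u (v - w) = bracket u v - bracket u w"
  "bracket (c *\<^sub>R u) w = c * bracket u w"
  "bracket u (c *\<^sub>R w) = c * bracket u w"
  "bracket u u = 0" "bracket 0 u = 0" "bracket u 0 = 0"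
  by (simp_all add: bracket_def algebra_simps)

lemma bracket_eq_0D:
  assumes "bracket u v = 0" "v \<noteq> 0"
  obtains c where "u = c *\<^sub>R v"
proof (cases "fst v = 0")
  case True
  then have "snd v \<noteq> 0" using assms(2) by (simp add: prod_eq_iff)
  then have "u = (snd u / snd v) *\<^sub>R v"
    using assms(1) True by (auto simp: bracket_def prod_eq_iff)
  then show ?thesis using that by blast
next
  case False
  then have "u = (fst u / fst v) *\<^sub>R v"
    using assms(1) by (auto simp: bracket_def prod_eq_iff field_simps)
  then show ?thesis using that by blast
qed

lemma side_at_0: "side_at V i 0 = V ! i"
  by (simp add: side_at_def)

lemma side_at_1: "side_at V i 1 = next_vertex V i"
  by (simp add: side_at_def side_vec_def)

lemma closed_side_eq: "closed_segment (V ! i) (next_vertex V i) = side_at V i ` {0..1}"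
  by (auto simp: closed_segment_def side_at_def side_vec_def image_iff algebra_simps
      Bex_def intro!: ext)

lemma boundary_iff: "z \<in> boundary V \<longleftrightarrow> (\<exists>k<length V. \<exists>u\<in>{0..1}. z = side_at V k u)"
  by (auto simp: boundary_def closed_side_eq)

lemma side_dist_convex:
  "side_dist V i (x + t *\<^sub>R (z - x)) = (1 - t) * side_dist V i x + t * side_dist V i z"
  by (simp add: side_dist_def bracket_simps algebra_simps)

lemma side_dist_side_at:
  "side_dist V i (side_at V k u) =
    (1 - u) * side_dist V i (V ! k) + u * side_dist V i (next_vertex V k)"
  by (simp add: side_dist_def side_at_def side_vec_def bracket_simps algebra_simps)

lemma side_dist_own [simp]: "side_dist V i (side_at V i u) = 0"
  by (simp add: side_dist_def side_at_def bracket_simps)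

lemma side_dist_vertex [simp]: "side_dist V i (V ! i) = 0"
  using side_dist_own[of V i 0] by (simp add: side_at_0)

lemma side_dist_next [simp]: "side_dist V i (next_vertex V i) = 0"
  using side_dist_own[of V i 1] by (simp add: side_at_1)

locale convex_polygon =
  fixes V :: "point list"
  assumes convex: "strictly_convex V"
begin

lemma length_ge: "3 \<le> length V"
  using convex by (simp add: strictly_convex_def)

lemma side_dist_nonneg_vertex:
  assumes "i < length V" "k < length V"
  shows "0 \<le> side_dist V i (V ! k)"
proof (cases "k = i \<or> k = Suc i mod length V")
  case True
  then show ?thesis
    using side_dist_vertex[of V i] side_dist_next[of V i] by (auto simp: next_vertex_def)
next
  case False
  then show ?thesis using convex assms by (auto simp: strictly_convex_def less_imp_le)
qed

lemma next_less: "Suc k mod length V < length V"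
  using length_ge by (intro mod_less_divisor) linarith

lemma side_vec_nonzero:
  assumes "i < length V" shows "side_vec V i \<noteq> 0"
proof -
  let ?k = "Suc (Suc i) mod length V"
  have "?k \<noteq> i \<and> ?k \<noteq> Suc i mod length V \<and> ?k < length V"
    using length_ge assms by (auto simp: mod_Suc split: if_splits)
  then have "0 < side_dist V i (V ! ?k)"
    using convex assms by (auto simp: strictly_convex_def)
  then show ?thesis by (auto simp: side_dist_def bracket_simps)
qed

lemma side_interior_eq:
  assumes "i < length V" shows "side_interior V i = side_at V i ` {0<..<1}"
proof -
  have "V ! i \<noteq> next_vertex V i"
    using side_vec_nonzero[OF assms] by (auto simp: side_vec_def)
  then show ?thesis
    by (auto simp: side_interior_def in_segment image_iff side_at_def side_vec_def algebra_simps
        Bex_def intro!: ext)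
qed

lemma side_at_interior: "i < length V \<Longrightarrow> 0 < u \<Longrightarrow> u < 1 \<Longrightarrow> side_at V i u \<in> side_interior V i"
  by (auto simp: side_interior_eq)

lemma side_dist_boundary_nonneg:
  assumes "i < length V" "z \<in> boundary V"
  shows "0 \<le> side_dist V i z"
  using assms side_dist_nonneg_vertex next_less
  by (auto simp: boundary_iff side_dist_side_at next_vertex_def)

text \<open>The distance is affine along side \<open>k\<close> and nonnegative at both ends, so it
  suffices that one end lies off the line of side \<open>i\<close>.\<close>

lemma side_dist_interior_pos:
  assumes "i < length V" "k < length V" "k \<noteq> i" "z \<in> side_interior V k"
  shows "0 < side_dist V i z"
proof -
  obtain u where u: "0 < u" "u < 1" "z = side_at V k u"
    using assms by (auto simp: side_interior_eq)
  have nn: "0 \<le> side_dist V i (V ! k)" "0 \<le> side_dist V i (next_vertex V k)"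
    using side_dist_nonneg_vertex assms next_less by (auto simp: next_vertex_def)
  have "0 < side_dist V i (V ! k) \<or> 0 < side_dist V i (next_vertex V k)"
  proof (cases "k = Suc i mod length V")
    case False
    then show ?thesis using convex assms by (auto simp: strictly_convex_def)
  next
    case True
    \<comment> \<open>The side after \<open>i\<close> starts on the line of \<open>i\<close>; its
      far end is off that line because there are at least three vertices.\<close>
    then have "Suc k mod length V \<noteq> i \<and> Suc k mod length V \<noteq> Suc i mod length V"
      using length_ge assms by (auto simp: mod_Suc split: if_splits)
    then show ?thesis using convex assms next_less by (auto simp: strictly_convex_def next_vertex_def)
  qed
  then show ?thesis
  proof
    assume "0 < side_dist V i (V ! k)"
    then show ?thesis using u nn by (simp add: side_dist_side_at add_pos_nonneg)
  next
    assume "0 < side_dist V i (next_vertex V k)"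
    then show ?thesis using u nn by (simp add: side_dist_side_at add_nonneg_pos)
  qed
qed

lemma side_dist_interior_zero: "i < length V \<Longrightarrow> z \<in> side_interior V i \<Longrightarrow> side_dist V i z = 0"
  by (auto simp: side_interior_eq)

lemma side_interior_unique:
  assumes "i < length V" "k < length V" "z \<in> side_interior V i" "z \<in> side_interior V k"
  shows "i = k"
  using side_dist_interior_pos[OF assms(1,2) _ assms(4)] side_dist_interior_zero[OF assms(1,3)] by fastforce

text \<open>Positivity forces \<open>i = k\<close>; then the side ending at \<open>V ! k\<close> has
  this vertex on its line, yet is at positive distance from the interior of side
  \<open>k\<close>.\<close>

lemma vertex_not_interior:
  assumes "k < length V" "i < length V"
  shows "V ! k \<notin> side_interior V i"
proof
  assume *: "V ! k \<in> side_interior V i"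
  have "i = k"
    using side_dist_interior_pos[OF assms(1,2) _ *] by fastforce
  let ?l = "if k = 0 then length V - 1 else k - 1"
  have "?l < length V" "next_vertex V ?l = V ! k" "?l \<noteq> k"
    using length_ge assms by (auto simp: next_vertex_def)
  with side_dist_interior_pos[of ?l i, OF _ assms(2) _ *] \<open>i = k\<close> side_dist_next[of V ?l]
  show False by simp
qed

text \<open>Evaluates the description in \<open>billiard_map\<close>. On the line through
  \<open>x\<close> and \<open>z\<close> every \<open>side_dist\<close> is affine in the parameter
  \<open>t\<close>: side \<open>i\<close> excludes \<open>t < 0\<close>, a side containing
  \<open>z\<close> excludes \<open>t > 1\<close>, and strictly between 0 and 1 all distances are
  positive.\<close>

lemma billiard_map_eq:
  assumes ij: "i < length V" "j < length V"
    and x: "x \<in> side_interior V i" and y: "y \<in> side_interior V j"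
    and z: "z \<in> boundary V" "0 < side_dist V i z" "bracket (z - x) (side_vec V j) = 0"
  shows "billiard_map V (x, y) = (y, z)"
proof -
  have zx: "z \<noteq> x" using z(2) side_dist_interior_zero[OF ij(1) x] by auto
  have "w = z" if w: "w \<in> boundary V" "w \<noteq> x" "k < length V" "y \<in> side_interior V k"
    "bracket (w - x) (side_vec V k) = 0" for w k
  proof -
    have "k = j" using side_interior_unique w(3,4) ij y by blast
    then obtain c where c: "w - x = c *\<^sub>R side_vec V j"
      using bracket_eq_0D w(5) side_vec_nonzero ij(2) by metis
    obtain d where d: "z - x = d *\<^sub>R side_vec V j"
      using bracket_eq_0D z(3) side_vec_nonzero ij(2) by metis
    have "d \<noteq> 0" using d zx by auto
    define t where "t = c / d"
    have "w - x = t *\<^sub>R (z - x)" using c d \<open>d \<noteq> 0\<close> by (simp add: t_def)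
    then have wt: "w = x + t *\<^sub>R (z - x)" by (metis add_diff_cancel_left' add_diff_eq)
    have gw: "side_dist V m w = (1 - t) * side_dist V m x + t * side_dist V m z" for m
      unfolding wt by (rule side_dist_convex)
    have "0 \<le> t * side_dist V i z"
      using gw[of i] side_dist_boundary_nonneg[OF ij(1) w(1)] side_dist_interior_zero[OF ij(1) x]
      by simp
    then have "0 \<le> t" using z(2) by (simp add: zero_le_mult_iff)
    have "t \<noteq> 0" using wt w(2) by auto
    obtain l where l: "l < length V" "side_dist V l z = 0"
      using z(1) by (auto simp: boundary_iff)
    have "l \<noteq> i" using l z(2) by auto
    then have "0 < side_dist V l x" using side_dist_interior_pos[OF l(1) ij(1) _ x] by auto
    moreover have "0 \<le> (1 - t) * side_dist V l x"
      using gw[of l] l(2) side_dist_boundary_nonneg[OF l(1) w(1)] by simp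
    ultimately have "t \<le> 1" by (simp add: zero_le_mult_iff)
    show "w = z"
    proof (cases "t = 1")
      case True
      then show ?thesis using wt by simp
    next
      case False
      with \<open>t \<le> 1\<close> \<open>0 \<le> t\<close> \<open>t \<noteq> 0\<close> have t: "0 < t" "t < 1" by auto
      obtain m where m: "m < length V" "side_dist V m w = 0"
        using w(1) by (auto simp: boundary_iff)
      have "0 < side_dist V m w"
      proof (cases "m = i")
        case True
        then show ?thesis
          using gw[of m] t z(2) side_dist_interior_zero[OF ij(1) x] by simp
      next
        case False
        then have "0 < side_dist V m x" using side_dist_interior_pos[OF m(1) ij(1) _ x] by auto
        moreover have "0 \<le> side_dist V m z" by (rule side_dist_boundary_nonneg[OF m(1) z(1)])
        ultimately show ?thesis
          using gw[of m] t by (simp add: add_pos_nonneg)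
      qed
      with m show ?thesis by simp
    qed
  qed
  then have "(THE w. w \<in> boundary V \<and> w \<noteq> x \<and>
      (\<exists>j<length V. y \<in> side_interior V j \<and> bracket (w - x) (side_vec V j) = 0)) = z"
    using z zx y ij by (intro the_equality) blast+
  then show ?thesis by (simp add: billiard_map_def)
qed

lemma billiard_map_side_at:
  assumes "i < length V" "j < length V" "k < length V"
    and "0 < x" "x < 1" "0 < y" "y < 1" "0 \<le> z" "z \<le> 1"
    and "0 < side_dist V i (side_at V k z)"
    and "bracket (side_at V k z - side_at V i x) (side_vec V j) = 0"
  shows "billiard_map V (side_at V i x, side_at V j y) = (side_at V j y, side_at V k z)"
  using assms by (intro billiard_map_eq[of i j]) (auto simp: side_at_interior boundary_iff Bex_def)

lemma phase_space_side_at: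
  assumes "p \<in> phase_space V"
  obtains i j x y where "i < length V" "j < length V" "0 < bracket (side_vec V i) (side_vec V j)"
    "0 < x" "x < 1" "0 < y" "y < 1" "p = (side_at V i x, side_at V j y)"
  using assms by (auto simp: phase_space_def side_interior_eq)

lemma side_at_phase_space:
  assumes "i < length V" "j < length V" "0 < bracket (side_vec V i) (side_vec V j)"
    "0 < x" "x < 1" "0 < y" "y < 1"
  shows "(side_at V i x, side_at V j y) \<in> phase_space V"
  using assms side_at_interior unfolding phase_space_def by blast

lemma phase_space_tail:
  "p \<in> phase_space V \<Longrightarrow> \<exists>i<length V. fst p \<in> side_interior V i"
  by (auto simp: phase_space_def)

lemma vertex_not_phase_space:
  assumes "k < length V" shows "(y, V ! k) \<notin> phase_space V"
  using vertex_not_interior[OF assms] by (auto simp: phase_space_def)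

definition tail_side :: "chord \<Rightarrow> nat"
  where "tail_side p = (THE i. i < length V \<and> fst p \<in> side_interior V i)"

lemma tail_side_eqI: "i < length V \<Longrightarrow> fst p \<in> side_interior V i \<Longrightarrow> tail_side p = i"
  unfolding tail_side_def by (rule the_equality) (blast intro: side_interior_unique)+

lemma tail_side_at: "i < length V \<Longrightarrow> 0 < x \<Longrightarrow> x < 1 \<Longrightarrow> tail_side (side_at V i x, y) = i"
  by (rule tail_side_eqI) (auto simp: side_at_interior)


section \<open>Itineraries and tiles\<close>

abbreviation T :: "chord \<Rightarrow> chord" where "T \<equiv> billiard_map V"

lemma funpow_funpow: "(T ^^ m) ((T ^^ k) p) = (T ^^ (m + k)) p"
  by (simp add: funpow_add)

fun run :: "nat list \<Rightarrow> chord \<Rightarrow> chord \<Rightarrow> bool" where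
  "run [] p q \<longleftrightarrow> p = q"
| "run (w # ws) p q \<longleftrightarrow> p \<in> phase_space V \<and> tail_side p = w \<and> run ws (T p) q"

lemma run_append: "run vs p q \<Longrightarrow> run ws q r \<Longrightarrow> run (vs @ ws) p r"
  by (induction vs arbitrary: p) auto

lemma run_Cons: "run [w] p q \<Longrightarrow> run ws q r \<Longrightarrow> run (w # ws) p r"
  by simp

lemma run_funpow: "run ws p q \<Longrightarrow> (T ^^ length ws) p = q"
  by (induction ws arbitrary: p) (auto simp: funpow_Suc_right simp del: funpow.simps)

lemma run_nth:
  "run ws p q \<Longrightarrow> k < length ws \<Longrightarrow>
    (T ^^ k) p \<in> phase_space V \<and> tail_side ((T ^^ k) p) = ws ! k"
proof (induction ws arbitrary: p k)
  case (Cons w ws)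
  then show ?case
    by (cases k) (auto simp: funpow_Suc_right simp del: funpow.simps(2))
qed simp

lemma run_side_at:
  assumes "i < length V" "j < length V" "k < length V" "k \<noteq> i"
    and "0 < x" "x < 1" "0 < y" "y < 1" "0 < z" "z < 1"
    and "0 < bracket (side_vec V i) (side_vec V j)"
    and "bracket (side_at V k z - side_at V i x) (side_vec V j) = 0"
  shows "run [i] (side_at V i x, side_at V j y) (side_at V j y, side_at V k z)"
proof -
  have "0 < side_dist V i (side_at V k z)"
    using side_dist_interior_pos assms side_at_interior by auto
  then show ?thesis
    using assms billiard_map_side_at[of i j k x y z] side_at_phase_space[of i j x y] tail_side_at
    by auto
qed

text \<open>Integer \<open>mod\<close> is nonnegative for a nonempty word, so the word repeats into
  the past as well.\<close>

definition periodic_word :: "nat list \<Rightarrow> int \<Rightarrow> nat"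
  where "periodic_word ws k = ws ! nat (k mod int (length ws))"

lemma is_orbit_funpow: "is_orbit V \<omega> \<Longrightarrow> (T ^^ n) (\<omega> k) = \<omega> (k + int n)"
  by (induction n) (auto simp: is_orbit_def algebra_simps)

lemma is_orbit_shift: "is_orbit V \<omega> \<Longrightarrow> is_orbit V (\<lambda>k. \<omega> (k + d))"
  by (auto simp: is_orbit_def algebra_simps)

lemma complete_points_orbit: "is_orbit V \<omega> \<Longrightarrow> \<omega> k \<in> complete_points V"
  using is_orbit_shift[of \<omega> k] unfolding complete_points_def by (auto intro!: exI[of _ "\<lambda>i. \<omega> (i + k)"])

lemma complete_points_phase_space: "p \<in> complete_points V \<Longrightarrow> p \<in> phase_space V"
  by (auto simp: complete_points_def is_orbit_def)

lemma complete_points_funpow: "p \<in> complete_points V \<Longrightarrow> (T ^^ n) p \<in> complete_points V"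
  using complete_points_orbit is_orbit_funpow unfolding complete_points_def by fastforce

lemma complete_points_step: "p \<in> complete_points V \<Longrightarrow> T p \<in> complete_points V"
  using complete_points_funpow[of p 1] by simp

lemma symbolic_orbit_complete: "symbolic_orbit V p \<sigma> \<Longrightarrow> p \<in> complete_points V"
  by (auto simp: symbolic_orbit_def complete_points_def)

text \<open>A closed run supplies its own past: time \<open>k\<close> is represented by its residue,
  so \<open>T\<close> need not be inverted.\<close>

lemma symbolic_orbit_run:
  assumes run: "run ws p p" and "ws \<noteq> []"
  shows "symbolic_orbit V p (periodic_word ws)"
proof -
  let ?n = "length ws"
  define \<omega> where "\<omega> k = (T ^^ nat (k mod int ?n)) p" for k
  have n: "0 < ?n" using assms(2) by simp
  have less: "nat (k mod int ?n) < ?n" for k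
    using n by (simp add: nat_less_iff)
  have per: "(T ^^ m) p = (T ^^ (m mod ?n)) p" for m
    using funpow_mod_eq[where f = T and n = ?n and x = p and m = m] run_funpow[OF run] by simp
  have step: "T (\<omega> k) = \<omega> (k + 1)" for k
  proof -
    \<comment> \<open>The successor of the last residue wraps to 0; \<open>per\<close> identifies
      the two iterates.\<close>
    have "nat ((k + 1) mod int ?n) = Suc (nat (k mod int ?n)) mod ?n"
    proof -
      have "int (Suc (nat (k mod int ?n)) mod ?n) = (k mod int ?n + 1) mod int ?n"
        using n by (simp add: zmod_int add.commute)
      also have "\<dots> = (k + 1) mod int ?n" by (simp add: mod_add_left_eq)
      finally show ?thesis by (metis nat_int)
    qed
    then show ?thesis
      unfolding \<omega>_def using per[of "Suc (nat (k mod int ?n))"] by simp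
  qed
  have ps: "\<omega> k \<in> phase_space V" "tail_side (\<omega> k) = periodic_word ws k" for k
    using run_nth[OF run less] by (auto simp: \<omega>_def periodic_word_def)
  have "periodic_word ws k < length V \<and> fst (\<omega> k) \<in> side_interior V (periodic_word ws k)" for k
  proof -
    obtain i where i: "i < length V" "fst (\<omega> k) \<in> side_interior V i"
      using phase_space_tail[OF ps(1)[of k]] by blast
    then show ?thesis using tail_side_eqI[OF i] ps(2)[of k] by simp
  qed
  moreover have "is_orbit V \<omega>" using ps(1) step by (simp add: is_orbit_def)
  moreover have "\<omega> 0 = p" by (simp add: \<omega>_def)
  ultimately show ?thesis unfolding symbolic_orbit_def by blast
qed

section \<open>Shifts of symbolic sequences and their action on tiles\<close>

definition shift :: "(int \<Rightarrow> nat) \<Rightarrow> int \<Rightarrow> int \<Rightarrow> nat"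
  where "shift \<sigma> d = (\<lambda>k. \<sigma> (k + d))"

lemma shift_shift [simp]: "shift (shift \<sigma> d) e = shift \<sigma> (d + e)"
  by (auto simp: shift_def algebra_simps)

lemma shift_0 [simp]: "shift \<sigma> 0 = \<sigma>"
  by (simp add: shift_def)

lemma shift_eq_iff: "shift \<sigma> d = shift \<tau> d \<longleftrightarrow> \<sigma> = \<tau>"
proof
  assume "shift \<sigma> d = shift \<tau> d"
  then have "shift (shift \<sigma> d) (- d) = shift (shift \<tau> d) (- d)" by simp
  then show "\<sigma> = \<tau>" by simp
qed simp

lemma shift_class_eq: "shift_class \<sigma> = range (shift \<sigma>)"
  by (auto simp: shift_class_def shift_def)

lemma shift_class_shift: "shift_class (shift \<sigma> d) = shift_class \<sigma>"
proof -
  have "\<exists>e. shift \<sigma> k = shift \<sigma> (d + e)" for k by (rule exI[of _ "k - d"]) simp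
  then show ?thesis by (auto simp: shift_class_eq)
qed

lemma symbolic_orbit_shift:
  assumes "symbolic_orbit V p \<sigma>"
  shows "symbolic_orbit V ((T ^^ n) p) (shift \<sigma> (int n))"
proof -
  obtain \<omega> where w: "is_orbit V \<omega>" "\<omega> 0 = p"
      "\<And>k. \<sigma> k < length V \<and> fst (\<omega> k) \<in> side_interior V (\<sigma> k)"
    using assms by (auto simp: symbolic_orbit_def)
  then show ?thesis
    using is_orbit_shift[OF w(1), of "int n"] is_orbit_funpow[OF w(1), of n 0]
    unfolding symbolic_orbit_def shift_def
    by (intro exI[of _ "\<lambda>k. \<omega> (k + int n)"]) simp
qed

text \<open>The past of \<open>q\<close> comes from the bi-infinite orbit that witnesses its
  sequence; this gives surjectivity of \<open>T ^^ n\<close> onto the shifted tile.\<close>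

lemma symbolic_orbit_unshift:
  assumes "symbolic_orbit V q (shift \<sigma> (int n))"
  obtains p where "symbolic_orbit V p \<sigma>" "q = (T ^^ n) p"
proof -
  obtain \<omega> where w: "is_orbit V \<omega>" "\<omega> 0 = q"
      "\<And>k. \<sigma> (k + int n) < length V \<and> fst (\<omega> k) \<in> side_interior V (\<sigma> (k + int n))"
    using assms by (auto simp: symbolic_orbit_def shift_def)
  have "symbolic_orbit V (\<omega> (- int n)) \<sigma>"
    using is_orbit_shift[OF w(1), of "- int n"] w(3)[of "_ - int n"]
    unfolding symbolic_orbit_def by (intro exI[of _ "\<lambda>k. \<omega> (k - int n)"]) simp
  moreover have "q = (T ^^ n) (\<omega> (- int n))"
    using is_orbit_funpow[OF w(1), of n "- int n"] w(2) by simp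
  ultimately show ?thesis using that by blast
qed

lemma funpow_image_tile: "(T ^^ n) ` tile V \<sigma> = tile V (shift \<sigma> (int n))"
  using symbolic_orbit_shift symbolic_orbit_unshift unfolding tile_def by blast

lemma tile_orbit_eq: "tile_orbit V (tile V \<sigma>) = {tile V (shift \<sigma> (int n)) | n. True}"
  by (auto simp: tile_orbit_def funpow_image_tile)

end

section \<open>Return times and orders under a common period\<close>

definition (in convex_polygon) least_period :: "(int \<Rightarrow> nat) \<Rightarrow> nat \<Rightarrow> bool"
  where "least_period \<sigma> n \<longleftrightarrow>
    1 \<le> n \<and> shift \<sigma> (int n) = \<sigma> \<and> (\<forall>j\<in>{1..<n}. shift \<sigma> (int j) \<noteq> \<sigma>)"

text \<open>\<open>N\<close> is any common period of the complete points, not a least one. It lets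
  the future of a point determine its past.\<close>

locale periodic_billiard = convex_polygon +
  fixes N :: nat
  assumes N_pos: "0 < N"
    and complete_periodic: "p \<in> complete_points V \<Longrightarrow> (T ^^ N) p = p"
begin

lemma funpow_mult_period: "p \<in> complete_points V \<Longrightarrow> (T ^^ (N * m)) p = p"
proof (induction m)
  case (Suc m)
  then show ?case by (simp add: funpow_add complete_periodic)
qed simp

text \<open>An orbit is determined by its point at time \<open>0\<close> also in the past, since it returns there.\<close>
lemma symbolic_orbit_unique:
  assumes "symbolic_orbit V p \<sigma>" "symbolic_orbit V p \<tau>"
  shows "\<sigma> = \<tau>"
proof
  fix k
  have "\<rho> k = tail_side ((T ^^ nat (k + int (N * nat \<bar>k\<bar>))) p)"
    if \<rho>: "symbolic_orbit V p \<rho>" for \<rho>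
  proof -
    obtain \<omega> where w: "is_orbit V \<omega>" "\<omega> 0 = p" "\<rho> k < length V"
        "fst (\<omega> k) \<in> side_interior V (\<rho> k)"
      using \<rho> by (auto simp: symbolic_orbit_def)
    have "\<bar>k\<bar> \<le> int (N * nat \<bar>k\<bar>)"
      using N_pos by (simp add: mult_le_cancel_right1)
    then have nonneg: "0 \<le> k + int (N * nat \<bar>k\<bar>)" by linarith
    have "\<omega> k = \<omega> (k + int (N * nat \<bar>k\<bar>))"
      using funpow_mult_period[OF complete_points_orbit[OF w(1), of k], of "nat \<bar>k\<bar>"]
        is_orbit_funpow[OF w(1), where n = "N * nat \<bar>k\<bar>" and k = k] by simp
    also have "\<dots> = (T ^^ nat (k + int (N * nat \<bar>k\<bar>))) p"
      using is_orbit_funpow[OF w(1), where n = "nat (k + int (N * nat \<bar>k\<bar>))" and k = 0] w(2) nonneg by simp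
    finally show ?thesis using tail_side_eqI[OF w(3), of "\<omega> k"] w(4) by simp
  qed
  from this[OF assms(1)] this[OF assms(2)] show "\<sigma> k = \<tau> k" by simp
qed

text \<open>A point of the tile is required, as all empty tiles coincide.\<close>

lemma tile_inject: "p \<in> tile V \<sigma> \<Longrightarrow> tile V \<sigma> = tile V \<tau> \<Longrightarrow> \<sigma> = \<tau>"
  using symbolic_orbit_unique unfolding tile_def by blast

lemma funpow_tile: "p \<in> tile V \<sigma> \<Longrightarrow> (T ^^ n) p \<in> tile V (shift \<sigma> (int n))"
  using symbolic_orbit_shift by (auto simp: tile_def)

lemma shift_mult_period: "shift \<sigma> (int n) = \<sigma> \<Longrightarrow> shift \<sigma> (int (n * m)) = \<sigma>"
proof (induction m)
  case (Suc m)
  have "shift \<sigma> (int (n * Suc m)) = shift (shift \<sigma> (int n)) (int (n * m))"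
    by (simp add: algebra_simps)
  then show ?case using Suc by simp
qed simp

text \<open>The remainder of \<open>m\<close> modulo \<open>n\<close> is again a period and smaller
  than \<open>n\<close>.\<close>

lemma least_period_dvd:
  assumes "least_period \<sigma> n" "shift \<sigma> (int m) = \<sigma>"
  shows "n dvd m"
proof -
  have n: "1 \<le> n" "shift \<sigma> (int n) = \<sigma>" using assms by (auto simp: least_period_def)
  have "shift \<sigma> (int (m mod n)) = shift (shift \<sigma> (int (n * (m div n)))) (int (m mod n))"
    using shift_mult_period[OF n(2)] by simp
  also have "\<dots> = shift \<sigma> (int m)"
    unfolding shift_shift by (metis mult_div_mod_eq of_nat_add)
  finally have "m mod n \<notin> {1..<n}" using assms by (auto simp: least_period_def)
  then have "m mod n = 0" using n(1) mod_less_divisor[of n m] by simp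
  then show ?thesis by auto
qed

lemma least_period_shift: "least_period \<sigma> n \<Longrightarrow> least_period (shift \<sigma> d) n"
proof -
  have "shift (shift \<sigma> d) (int j) = shift \<sigma> d \<longleftrightarrow> shift \<sigma> (int j) = \<sigma>" for j
    using shift_eq_iff[of "shift \<sigma> (int j)" d \<sigma>] by (simp add: add.commute)
  then show "least_period \<sigma> n \<Longrightarrow> least_period (shift \<sigma> d) n"
    unfolding least_period_def by blast
qed

lemma period_dvd:
  assumes "least_period \<sigma> n" "p \<in> tile V \<sigma>" "(T ^^ m) p = p"
  shows "n dvd m"
  using least_period_dvd[OF assms(1)] funpow_tile[OF assms(2), of m] assms(2,3)
    symbolic_orbit_unique by (auto simp: tile_def)

lemma has_return_time_tile:
  assumes "least_period \<sigma> n" "p \<in> tile V \<sigma>"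
  shows "has_return_time V (tile V \<sigma>) n"
  unfolding has_return_time_def funpow_image_tile
proof (intro conjI ballI notI)
  show "1 \<le> n" "tile V (shift \<sigma> (int n)) = tile V \<sigma>"
    using assms(1) by (simp_all add: least_period_def)
  fix j assume j: "j \<in> {1..<n}" "tile V (shift \<sigma> (int j)) = tile V \<sigma>"
  have "shift \<sigma> (int j) = \<sigma>" using tile_inject[OF assms(2) j(2)[symmetric]] by (rule sym)
  then show False using j(1) assms(1) by (auto simp: least_period_def)
qed

text \<open>\<open>T ^^ k\<close> is injective on complete points, being undone by
  \<open>T ^^ (N * k - k)\<close>.\<close>

lemma funpow_commute_eq:
  assumes "q \<in> complete_points V" "(T ^^ m) ((T ^^ k) q) = (T ^^ k) q"
  shows "(T ^^ m) q = q"
proof -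
  have "N * k - k + k = N * k" using N_pos by simp
  then have q: "q = (T ^^ (N * k - k)) ((T ^^ k) q)"
    using funpow_mult_period[OF assms(1), of k] unfolding funpow_funpow by metis
  have "(T ^^ m) q = (T ^^ m) ((T ^^ (N * k - k)) ((T ^^ k) q))"
    using q by (rule arg_cong)
  also have "\<dots> = (T ^^ (N * k - k)) ((T ^^ m) ((T ^^ k) q))"
    unfolding funpow_funpow by (simp only: ac_simps)
  also have "\<dots> = q" using assms(2) q[symmetric] by simp
  finally show ?thesis .
qed

text \<open>All data are given for one tile; conjugation by \<open>T ^^ k\<close> carries them to
  the other tiles of its orbit. A single point \<open>q\<close> witnesses the order for all
  \<open>j\<close> at once, where \<open>has_order_on\<close> allows a different point for each
  \<open>j\<close>.\<close>

lemma tile_orbit_member: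
  assumes \<sigma>: "least_period \<sigma> n" and r: "1 \<le> r"
    and p: "\<And>p. p \<in> tile V \<sigma> \<Longrightarrow> (T ^^ (n * r)) p = p"
    and q: "q \<in> tile V \<sigma>" "\<And>j. 1 \<le> j \<Longrightarrow> j < r \<Longrightarrow> (T ^^ (n * j)) q \<noteq> q"
    and M: "M \<in> tile_orbit V (tile V \<sigma>)"
  shows "has_return_time V M n" "has_order_on V M n r"
proof -
  obtain k where k: "M = tile V (shift \<sigma> (int k))" using M by (auto simp: tile_orbit_eq)
  then have Mk: "M = (T ^^ k) ` tile V \<sigma>" by (simp add: funpow_image_tile)
  show "has_return_time V M n"
    unfolding k using least_period_shift[OF \<sigma>] funpow_tile[OF q(1)] by (rule has_return_time_tile)
  have "(T ^^ (n * r)) x = x" if "x \<in> M" for x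
  proof -
    from that obtain y where y: "y \<in> tile V \<sigma>" "x = (T ^^ k) y" using Mk by auto
    have "(T ^^ (n * r)) x = (T ^^ k) ((T ^^ (n * r)) y)"
      unfolding y(2) funpow_funpow by (simp add: add.commute)
    then show ?thesis using p y by simp
  qed
  moreover have "(T ^^ (n * j)) ((T ^^ k) q) \<noteq> (T ^^ k) q" if "1 \<le> j" "j < r" for j
    using funpow_commute_eq[of q "n * j" k] q(2)[OF that] symbolic_orbit_complete q(1)
    by (auto simp: tile_def)
  ultimately show "has_order_on V M n r"
    using r imageI[OF q(1), of "T ^^ k"] unfolding has_order_on_def funpow_mult Mk[symmetric]
    by (fastforce simp: mult.commute)
qed

lemma has_return_time_unique: "has_return_time V M n \<Longrightarrow> has_return_time V M m \<Longrightarrow> n = m"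
  unfolding has_return_time_def by (cases n m rule: linorder_cases) auto

end

section \<open>The first return map of the Penthouse\<close>

definition word_left :: "nat list" where "word_left = [3, 4, 0, 1, 2, 4, 1]"
definition word_right :: "nat list" where "word_right = [3, 4, 1, 3, 0, 1, 2]"
definition word_roof :: "nat list" where "word_roof = [3, 4, 1]"

locale penthouse_billiard =
  fixes a b :: real
  assumes a_ge: "1 \<le> a" and b_pos: "0 < b" and b_less: "b < 1"
begin

abbreviation V :: "point list" where "V \<equiv> penthouse a b"

lemma length_V: "length V = 5"
  by (simp add: penthouse_def)

lemma side_vec_V:
  "side_vec V 0 = (0, -1)" "side_vec V (Suc 0) = (1, 0)" "side_vec V 2 = (0, 1)"
  "side_vec V 3 = (b - 1, a)" "side_vec V 4 = (- b, - a)"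
  by (simp_all add: side_vec_def next_vertex_def penthouse_def)

lemma vertex_V:
  "V ! 0 = (0, 1)" "V ! Suc 0 = (0, 0)" "V ! 2 = (1, 0)" "V ! 3 = (1, 1)" "V ! 4 = (b, 1 + a)"
  by (simp_all add: penthouse_def)

lemma side_at_V:
  "side_at V 0 u = (0, 1 - u)" "side_at V (Suc 0) u = (u, 0)" "side_at V 2 u = (1, u)"
  "side_at V 3 u = (1 - u * (1 - b), 1 + u * a)" "side_at V 4 u = (b - u * b, 1 + a - u * a)"
  by (simp_all add: side_at_def side_vec_V vertex_V algebra_simps)

lemma less_5: "i < (5 :: nat) \<longleftrightarrow> i = 0 \<or> i = Suc 0 \<or> i = 2 \<or> i = 3 \<or> i = 4"
  by auto

lemma ab_facts: "0 < a" "b < a" "1 - b < a" "b - 1 < a" "a * b < a" "0 < a * b" "0 < b * a" "b * a < a"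
  using a_ge b_pos b_less by (auto simp: mult_less_cancel_left1 mult_less_cancel_right1)

lemma strictly_convex_V: "strictly_convex V"
  using ab_facts b_pos b_less
  unfolding strictly_convex_def length_V less_5
  by (auto simp: side_dist_def side_vec_V vertex_V bracket_def algebra_simps)

sublocale convex_polygon V
  by unfold_locales (rule strictly_convex_V)

text \<open>The parallel to \<open>EA\<close> through the point of \<open>DE\<close> at parameter distance \<open>r\<close> from \<open>E\<close> passes
  through \<open>B\<close> for \<open>r = \<alpha>\<close>, and the parallel to \<open>DE\<close> through \<open>(x, 0)\<close> passes through \<open>A\<close> for
  \<open>x = \<beta>\<close>.\<close>
definition \<alpha> :: real where "\<alpha> = b / a"
definition \<beta> :: real where "\<beta> = (1 - b) / a"
definition \<delta> :: real where "\<delta> = 1 / a"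

lemma greek: "0 < \<alpha>" "0 < \<beta>" "\<alpha> + \<beta> = \<delta>" "\<delta> \<le> 1" "a * \<alpha> = b" "a * \<beta> = 1 - b" "a * \<delta> = 1"
  "\<alpha> * a = b" "\<beta> * a = 1 - b"
  using a_ge b_pos b_less by (auto simp: \<alpha>_def \<beta>_def \<delta>_def field_simps)

lemma mult_greek: "a * (x * \<alpha>) = b * x" "b * x + a * (x * \<beta>) = x"
  using a_ge by (simp_all add: \<alpha>_def \<beta>_def field_simps)

text \<open>Side 3 runs towards \<open>E\<close> and side 4 away from it, hence \<open>1 - r\<close>
  next to \<open>t\<close>.\<close>

definition roof_chord :: "real \<Rightarrow> real \<Rightarrow> chord"
  where "roof_chord r t = (side_at V 3 (1 - r), side_at V 4 t)"

definition h :: "real \<Rightarrow> real"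
  where "h r = (if r < \<delta> then \<delta> - r else 1 + \<delta> - r)"

section \<open>Single bounces, regular and singular\<close>

lemmas step_simps = length_V side_vec_V side_at_V bracket_def

text \<open>The digits in these names are the sides of tail and head. Only the pairs (1,2), (3,4)
  and (1,3) split, at b, \<alpha> and \<beta>: there the parallel passes through \<open>E\<close>,
  \<open>B\<close> and \<open>A\<close>, respectively. The coordinate \<open>y\<close> of the head
  never enters the landing point.\<close>

lemma run_01: "0 < x \<Longrightarrow> x < 1 \<Longrightarrow> 0 < y \<Longrightarrow> y < 1 \<Longrightarrow>
    run [0] (side_at V 0 x, side_at V 1 y) (side_at V 1 y, side_at V 2 (1 - x))"
  by (rule run_side_at) (simp_all add: step_simps)

lemma run_12_right: "b < x \<Longrightarrow> x < 1 \<Longrightarrow> 0 < y \<Longrightarrow> y < 1 \<Longrightarrow>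
    run [1] (side_at V 1 x, side_at V 2 y) (side_at V 2 y, side_at V 3 ((1 - x) / (1 - b)))"
  using b_pos b_less by (intro run_side_at) (simp_all add: step_simps)

lemma run_12_left: "0 < x \<Longrightarrow> x < b \<Longrightarrow> 0 < y \<Longrightarrow> y < 1 \<Longrightarrow>
    run [1] (side_at V 1 x, side_at V 2 y) (side_at V 2 y, side_at V 4 (1 - x / b))"
  using b_pos b_less by (intro run_side_at) (simp_all add: step_simps field_simps)

lemma mult_greek_less: "0 < u \<Longrightarrow> u < 1 \<Longrightarrow> 0 < \<beta> * u \<and> \<beta> * u < \<beta> \<and> 0 < \<alpha> * u \<and> \<alpha> * u < \<alpha> \<and> \<beta> < 1 \<and> \<alpha> < 1"
  using greek by (auto simp: mult_less_cancel_left1 mult_less_cancel_left2)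

lemma run_23: "0 < x \<Longrightarrow> x < 1 \<Longrightarrow> 0 < y \<Longrightarrow> y < 1 \<Longrightarrow>
    run [2] (side_at V 2 x, side_at V 3 y) (side_at V 3 y, side_at V 4 (\<beta> * (1 - x)))"
  using mult_greek_less[of "1 - x"] b_less greek(6)
  by (intro run_side_at) (auto simp: step_simps algebra_simps mult_greek)

lemma run_34_left: "0 < r \<Longrightarrow> r < \<alpha> \<Longrightarrow> 0 < y \<Longrightarrow> y < 1 \<Longrightarrow>
    run [3] (side_at V 3 (1 - r), side_at V 4 y) (side_at V 4 y, side_at V 0 (r / \<alpha>))"
  using mult_greek_less[of "1/2"] greek(1) ab_facts(1)
  by (intro run_side_at) (auto simp: step_simps field_simps mult_greek)

lemma run_34_bottom: "\<alpha> < r \<Longrightarrow> r < 1 \<Longrightarrow> 0 < y \<Longrightarrow> y < 1 \<Longrightarrow>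
    run [3] (side_at V 3 (1 - r), side_at V 4 y) (side_at V 4 y, side_at V 1 (r - \<alpha>))"
  using greek(1,8) ab_facts(1)
  by (intro run_side_at) (auto simp: step_simps algebra_simps)

lemma run_40: "0 < x \<Longrightarrow> x < 1 \<Longrightarrow> 0 < y \<Longrightarrow> y < 1 \<Longrightarrow>
    run [4] (side_at V 4 x, side_at V 0 y) (side_at V 0 y, side_at V 1 (b * (1 - x)))"
  using b_pos b_less mult_strict_mono[of b 1 "1 - x" 1]
  by (intro run_side_at) (auto simp: step_simps algebra_simps)

lemma run_30: "0 < r \<Longrightarrow> r < 1 \<Longrightarrow> 0 < y \<Longrightarrow> y < 1 \<Longrightarrow>
    run [3] (side_at V 3 (1 - r), side_at V 0 y)
      (side_at V 0 y, side_at V 1 (1 - (1 - b) * (1 - r)))"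
  using b_pos b_less mult_strict_mono[of "1 - b" 1 "1 - r" 1]
  by (intro run_side_at) (auto simp: step_simps)

lemma run_13_roof: "\<beta> < x \<Longrightarrow> x < 1 \<Longrightarrow> 0 < y \<Longrightarrow> y < 1 \<Longrightarrow>
    run [1] (side_at V 1 x, side_at V 3 y) (side_at V 3 y, side_at V 4 (1 + \<beta> - x))"
  using greek(2,9) ab_facts(1)
  by (intro run_side_at) (auto simp: step_simps algebra_simps)

lemma run_13_left: "0 < x \<Longrightarrow> x < \<beta> \<Longrightarrow> 0 < y \<Longrightarrow> y < 1 \<Longrightarrow>
    run [1] (side_at V 1 x, side_at V 3 y) (side_at V 3 y, side_at V 0 (1 - x / \<beta>))"
  using mult_greek_less[of "1/2"] greek(2) ab_facts(1)
  by (intro run_side_at) (auto simp: step_simps field_simps mult_greek)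

lemma run_41: "0 < x \<Longrightarrow> x < 1 \<Longrightarrow> 0 < y \<Longrightarrow> y < 1 \<Longrightarrow>
    run [4] (side_at V 4 x, side_at V 1 y) (side_at V 1 y, side_at V 3 (1 - x))"
  using ab_facts(1) by (intro run_side_at) (auto simp: step_simps algebra_simps)

lemma run_24: "0 < x \<Longrightarrow> x < 1 \<Longrightarrow> 0 < y \<Longrightarrow> y < 1 \<Longrightarrow>
    run [2] (side_at V 2 x, side_at V 4 y) (side_at V 4 y, side_at V 1 (1 - \<alpha> * x))"
  using mult_greek_less[of x] b_pos greek(8)
  by (intro run_side_at) (auto simp: step_simps algebra_simps)

text \<open>A vertex is still a boundary point, so the map can be evaluated with parameter 0 on side
  \<open>k\<close>; the new chord leaves the phase space because no vertex is interior to a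
  side.\<close>

lemma step_vertex:
  assumes "i < 5" "j < 5" "k < 5" "0 < x" "x < 1" "0 < y" "y < 1"
    and "0 < side_dist V i (V ! k)" "bracket (V ! k - side_at V i x) (side_vec V j) = 0"
  shows "T (side_at V i x, side_at V j y) \<notin> phase_space V"
  using billiard_map_side_at[of i j k x y 0] vertex_not_phase_space[of k] assms
  by (simp add: length_V side_at_0)

lemma stop_12: "0 < y \<Longrightarrow> y < 1 \<Longrightarrow> T (side_at V 1 b, side_at V 2 y) \<notin> phase_space V"
  using b_pos b_less ab_facts
  by (intro step_vertex[where k = 4]) (auto simp: step_simps side_dist_def vertex_V)

lemma stop_34: "0 < y \<Longrightarrow> y < 1 \<Longrightarrow> T (side_at V 3 (1 - \<alpha>), side_at V 4 y) \<notin> phase_space V"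
  using b_pos b_less ab_facts greek
  by (intro step_vertex[where k = 1]) (auto simp: step_simps side_dist_def vertex_V algebra_simps)

lemma stop_13: "0 < y \<Longrightarrow> y < 1 \<Longrightarrow> T (side_at V 1 \<beta>, side_at V 3 y) \<notin> phase_space V"
  using b_pos b_less ab_facts greek
  by (intro step_vertex[where k = 0]) (auto simp: step_simps side_dist_def vertex_V algebra_simps)

text \<open>Points of even index carry only \<open>r\<close>, those of odd index only
  \<open>t\<close>. For the latter the vertical bounces 2 and 4 cancel, and the horizontal bounce 6
  carries the distance \<open>t\<close> from \<open>E\<close> across the roof.\<close>

lemma run_left:
  assumes "0 < r" "r < \<alpha>" "0 < t" "t < 1"
  shows "run word_left (roof_chord r t) (roof_chord t (\<delta> - r))"
proof -
  have r: "0 < r / \<alpha>" "r / \<alpha> < 1" "\<alpha> * (1 - r / \<alpha>) = \<alpha> - r" and t: "0 < b * (1 - t)" "b * (1 - t) < b"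
    using assms greek b_pos by (auto simp: field_simps)
  have less: "\<alpha> < 1" "\<alpha> + \<beta> \<le> 1" using greek by auto
  note 1 = run_34_left[OF assms]
  note 2 = run_40[OF assms(3,4) r(1,2)]
  have 3: "run [0] (side_at V 0 (r / \<alpha>), side_at V 1 (b * (1 - t)))
      (side_at V 1 (b * (1 - t)), side_at V 2 (1 - r / \<alpha>))"
    using r t b_less by (intro run_01) auto
  have 4: "run [1] (side_at V 1 (b * (1 - t)), side_at V 2 (1 - r / \<alpha>))
      (side_at V 2 (1 - r / \<alpha>), side_at V 4 t)"
    using run_12_left[of "b * (1 - t)" "1 - r / \<alpha>"] r t b_pos by simp
  have 5: "run [2] (side_at V 2 (1 - r / \<alpha>), side_at V 4 t)
      (side_at V 4 t, side_at V 1 (1 - \<alpha> + r))"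
    using run_24[of "1 - r / \<alpha>" t] r assms by (simp add: diff_diff_eq2 diff_add_eq)
  have 6: "run [4] (side_at V 4 t, side_at V 1 (1 - \<alpha> + r))
      (side_at V 1 (1 - \<alpha> + r), side_at V 3 (1 - t))"
    using assms less by (intro run_41) auto
  have 7: "run [1] (side_at V 1 (1 - \<alpha> + r), side_at V 3 (1 - t))
      (side_at V 3 (1 - t), side_at V 4 (\<delta> - r))"
    using run_13_roof[of "1 - \<alpha> + r" "1 - t"] assms less greek(3)
    by (simp add: algebra_simps)
  show ?thesis
    unfolding word_left_def roof_chord_def
    by (rule run_Cons[OF 1 run_Cons[OF 2 run_Cons[OF 3 run_Cons[OF 4 run_Cons[OF 5 run_Cons[OF 6 7]]]]]])
qed

text \<open>As in \<open>run_left\<close>, but the horizontal bounce comes first and the two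
  vertical ones cancel on the right roof side. \<open>x\<close> and \<open>y\<close> are the
  parameters on the left wall and on the bottom.\<close>

lemma run_right:
  assumes "\<alpha> < r" "r < \<delta>" "0 < t" "t < 1"
  shows "run word_right (roof_chord r t) (roof_chord t (\<delta> - r))"
proof -
  define x where "x = 1 - (r - \<alpha>) / \<beta>"
  define y where "y = 1 - (1 - b) * (1 - t)"
  have x: "0 < x" "x < 1" "\<beta> * x = \<delta> - r"
    using assms greek by (auto simp: field_simps x_def)
  have "0 < (1 - b) * (1 - t)" "(1 - b) * (1 - t) < 1 - b"
    using assms b_less by simp_all
  then have y: "b < y" "y < 1" unfolding y_def by linarith+
  have y': "(1 - y) / (1 - b) = 1 - t" using b_less by (simp add: y_def)
  have r: "r < 1" "\<beta> \<le> 1" using assms greek by auto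
  note 1 = run_34_bottom[OF assms(1) r(1) assms(3,4)]
  have 2: "run [4] (side_at V 4 t, side_at V 1 (r - \<alpha>)) (side_at V 1 (r - \<alpha>), side_at V 3 (1 - t))"
    using assms r greek by (intro run_41) auto
  have 3: "run [1] (side_at V 1 (r - \<alpha>), side_at V 3 (1 - t)) (side_at V 3 (1 - t), side_at V 0 x)"
    unfolding x_def using assms r greek by (intro run_13_left) auto
  have 4: "run [3] (side_at V 3 (1 - t), side_at V 0 x) (side_at V 0 x, side_at V 1 y)"
    using run_30[of t x] assms x y unfolding y_def by simp
  have 5: "run [0] (side_at V 0 x, side_at V 1 y) (side_at V 1 y, side_at V 2 (1 - x))"
    using x y b_pos by (intro run_01) auto
  have 6: "run [1] (side_at V 1 y, side_at V 2 (1 - x)) (side_at V 2 (1 - x), side_at V 3 (1 - t))"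
    using run_12_right[of y "1 - x"] x y y' by simp
  have 7: "run [2] (side_at V 2 (1 - x), side_at V 3 (1 - t)) (side_at V 3 (1 - t), side_at V 4 (\<delta> - r))"
    using run_23[of "1 - x" "1 - t"] x assms by simp
  show ?thesis
    unfolding word_right_def roof_chord_def
    by (rule run_Cons[OF 1 run_Cons[OF 2 run_Cons[OF 3 run_Cons[OF 4 run_Cons[OF 5 run_Cons[OF 6 7]]]]]])
qed

lemma run_roof:
  assumes "\<delta> < r" "r < 1" "0 < t" "t < 1"
  shows "run word_roof (roof_chord r t) (roof_chord t (1 + \<delta> - r))"
proof -
  have r: "\<alpha> < r" "\<beta> < r - \<alpha>" "0 < r - \<alpha>" "r - \<alpha> < 1" using assms greek by auto
  note 1 = run_34_bottom[OF r(1) assms(2-4)]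
  note 2 = run_41[OF assms(3,4) r(3,4)]
  have 3: "run [1] (side_at V 1 (r - \<alpha>), side_at V 3 (1 - t))
      (side_at V 3 (1 - t), side_at V 4 (1 + \<delta> - r))"
    using run_13_roof[of "r - \<alpha>" "1 - t"] r assms greek(3) by (simp add: algebra_simps)
  show ?thesis
    unfolding word_roof_def roof_chord_def by (rule run_Cons[OF 1 run_Cons[OF 2 3]])
qed

text \<open>The values at \<alpha> and \<delta> are arbitrary: complete orbits avoid both.\<close>

definition return_word :: "real \<Rightarrow> nat list"
  where "return_word r = (if r < \<alpha> then word_left else if r < \<delta> then word_right else word_roof)"

lemma run_return:
  assumes "0 < r" "r < 1" "r \<noteq> \<alpha>" "r \<noteq> \<delta>" "0 < t" "t < 1"
  shows "run (return_word r) (roof_chord r t) (roof_chord t (h r))"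
  using assms greek run_left[of r t] run_right[of r t] run_roof[of r t]
  by (auto simp: return_word_def h_def not_less le_less)

lemma h_bounds: "0 < r \<Longrightarrow> r < 1 \<Longrightarrow> r \<noteq> \<delta> \<Longrightarrow> 0 < h r \<and> h r < 1 \<and> h r \<noteq> \<delta> \<and> h (h r) = r"
  using greek by (auto simp: h_def)

text \<open>The itinerary changes at these two parameters because the orbit runs into a vertex: into
  \<open>B\<close> at once for \<alpha>, and into \<open>A\<close> after two regular bounces for
  \<delta>, where \<open>r - \<alpha> = \<beta>\<close>.\<close>

lemma roof_complete:
  assumes p: "roof_chord r t \<in> complete_points V" and "0 < r" "r < 1" "0 < t" "t < 1"
  shows "r \<noteq> \<alpha> \<and> r \<noteq> \<delta>"
proof (intro conjI notI)
  assume "r = \<alpha>"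
  then show False
    using stop_34[of t] complete_points_phase_space[OF complete_points_step[OF p]] assms
    by (simp add: roof_chord_def)
next
  assume "r = \<delta>"
  then have r: "\<alpha> < r" "r - \<alpha> = \<beta>" "0 < \<beta>" "\<beta> < 1" using greek assms by auto
  have "T (T (roof_chord r t)) = (side_at V 1 \<beta>, side_at V 3 (1 - t))"
    using run_34_bottom[OF r(1) assms(3-5)] run_41[OF assms(4,5) r(3,4)] r(2)
    by (simp add: roof_chord_def)
  then show False
    using stop_13[of "1 - t"] assms
      complete_points_phase_space[OF complete_points_funpow[OF p, of 3]]
    by (simp add: numeral_3_eq_3)
qed

section \<open>Every complete orbit meets the roof section\<close>

definition reaches_roof :: "nat \<Rightarrow> chord \<Rightarrow> bool"
  where "reaches_roof n p \<longleftrightarrow>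
    (\<exists>m\<le>n. \<exists>r t. 0 < r \<and> r < 1 \<and> 0 < t \<and> t < 1 \<and> (T ^^ m) p = roof_chord r t)"

lemma reaches_roof_mono: "reaches_roof m p \<Longrightarrow> m \<le> n \<Longrightarrow> reaches_roof n p"
  unfolding reaches_roof_def using order_trans by blast

lemma reaches_roof_step:
  assumes "run [w] p q" "reaches_roof n q"
  shows "reaches_roof (Suc n) p"
proof -
  obtain m r t where "m \<le> n" "0 < r \<and> r < 1 \<and> 0 < t \<and> t < 1 \<and> (T ^^ m) q = roof_chord r t"
    using assms(2) unfolding reaches_roof_def by blast
  moreover have "(T ^^ Suc m) p = (T ^^ m) q"
    using assms(1) by (simp add: funpow_Suc_right del: funpow.simps)
  ultimately show ?thesis
    unfolding reaches_roof_def by (intro exI[of _ "Suc m"]) auto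
qed

lemma reaches_roof_34: "0 < x \<Longrightarrow> x < 1 \<Longrightarrow> 0 < y \<Longrightarrow> y < 1 \<Longrightarrow> reaches_roof 0 (side_at V 3 x, side_at V 4 y)"
  unfolding reaches_roof_def roof_chord_def
  by (intro exI[of _ 0] conjI exI[of _ "1 - x"] exI[of _ y]) auto

lemma reaches_roof_23: "0 < x \<Longrightarrow> x < 1 \<Longrightarrow> 0 < y \<Longrightarrow> y < 1 \<Longrightarrow> reaches_roof 1 (side_at V 2 x, side_at V 3 y)"
  using reaches_roof_step[OF run_23 reaches_roof_34, of x y] mult_greek_less[of "1 - x"] by simp

lemma reaches_roof_12_right:
  assumes "b < x" "x < 1" "0 < y" "y < 1"
  shows "reaches_roof 2 (side_at V 1 x, side_at V 2 y)"
  using reaches_roof_step[OF run_12_right reaches_roof_23, of x y] assms by (simp add: numeral_2_eq_2)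

text \<open>Breaks the only cycle of side pairs that avoids (3,4), namely 30, 01, 12, 24, 41, 13:
  the landing point on the bottom lies to the right of b, so the orbit goes on to the right roof
  side.\<close>

lemma reaches_roof_30:
  assumes "0 < x" "x < 1" "0 < y" "y < 1"
  shows "reaches_roof 4 (side_at V 3 x, side_at V 0 y)"
proof -
  define z where "z = 1 - (1 - b) * x"
  have z: "b < z" "z < 1" using assms b_less mult_strict_left_mono[of x 1 "1 - b"] unfolding z_def
    by (simp_all add: algebra_simps)
  have "run [3] (side_at V 3 x, side_at V 0 y) (side_at V 0 y, side_at V 1 z)"
    using run_30[of "1 - x" y] assms by (simp add: z_def)
  moreover have "run [0] (side_at V 0 y, side_at V 1 z) (side_at V 1 z, side_at V 2 (1 - y))"
    using assms z b_pos by (intro run_01) auto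
  moreover have "reaches_roof 2 (side_at V 1 z, side_at V 2 (1 - y))"
    using assms z by (intro reaches_roof_12_right) auto
  ultimately show ?thesis
    using reaches_roof_step[of 3 "(side_at V 3 x, side_at V 0 y)" _ 3] reaches_roof_step[of 0 _ _ 2]
    by simp
qed

lemma run_complete: "run [w] p q \<Longrightarrow> p \<in> complete_points V \<Longrightarrow> q \<in> complete_points V"
  using complete_points_step[of p] by simp

lemma reaches_roof_13:
  assumes "0 < x" "x < 1" "0 < y" "y < 1"
    and "(side_at V 1 x, side_at V 3 y) \<in> complete_points V"
  shows "reaches_roof 5 (side_at V 1 x, side_at V 3 y)"
proof -
  have "x \<noteq> \<beta>"
    using stop_13[of y] complete_points_phase_space[OF complete_points_step[OF assms(5)]] assms by auto
  then consider "x < \<beta>" | "\<beta> < x" by linarith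
  then show ?thesis
  proof cases
    case 1
    then have "reaches_roof 4 (side_at V 3 y, side_at V 0 (1 - x / \<beta>))"
      using assms by (intro reaches_roof_30) auto
    from reaches_roof_step[OF run_13_left[OF assms(1) 1 assms(3,4)] this] show ?thesis by simp
  next
    case 2
    then have "reaches_roof 0 (side_at V 3 y, side_at V 4 (1 + \<beta> - x))"
      using assms greek by (intro reaches_roof_34) auto
    from reaches_roof_step[OF run_13_roof[OF 2 assms(2-4)] this] reaches_roof_mono show ?thesis by simp
  qed
qed

lemma reaches_roof_41:
  assumes "0 < x" "x < 1" "0 < y" "y < 1"
    and "(side_at V 4 x, side_at V 1 y) \<in> complete_points V"
  shows "reaches_roof 6 (side_at V 4 x, side_at V 1 y)"
  using reaches_roof_step[OF run_41[OF assms(1-4)] reaches_roof_13[OF assms(3,4) _ _ run_complete[OF run_41[OF assms(1-4)] assms(5)]]]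
    assms by simp

lemma reaches_roof_24:
  assumes "0 < x" "x < 1" "0 < y" "y < 1"
    and "(side_at V 2 x, side_at V 4 y) \<in> complete_points V"
  shows "reaches_roof 7 (side_at V 2 x, side_at V 4 y)"
  using reaches_roof_step[OF run_24[OF assms(1-4)] reaches_roof_41[OF assms(3,4) _ _ run_complete[OF run_24[OF assms(1-4)] assms(5)]]]
    mult_greek_less[of x] assms by simp

lemma reaches_roof_12:
  assumes "0 < x" "x < 1" "0 < y" "y < 1"
    and "(side_at V 1 x, side_at V 2 y) \<in> complete_points V"
  shows "reaches_roof 8 (side_at V 1 x, side_at V 2 y)"
proof -
  have "x \<noteq> b"
    using stop_12[of y] complete_points_phase_space[OF complete_points_step[OF assms(5)]] assms by auto
  then consider "x < b" | "b < x" by linarith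
  then show ?thesis
  proof cases
    case 1
    note run = run_12_left[OF assms(1) 1 assms(3,4)]
    show ?thesis
      using reaches_roof_step[OF run reaches_roof_24[OF assms(3,4) _ _ run_complete[OF run assms(5)]]]
        assms 1 by simp
  next
    case 2
    then show ?thesis using reaches_roof_12_right[OF 2 assms(2-4)] reaches_roof_mono by simp
  qed
qed

lemma reaches_roof_01:
  assumes "0 < x" "x < 1" "0 < y" "y < 1"
    and "(side_at V 0 x, side_at V 1 y) \<in> complete_points V"
  shows "reaches_roof 9 (side_at V 0 x, side_at V 1 y)"
  using reaches_roof_step[OF run_01[OF assms(1-4)] reaches_roof_12[OF assms(3,4) _ _ run_complete[OF run_01[OF assms(1-4)] assms(5)]]]
    assms by simp

lemma reaches_roof_40:
  assumes "0 < x" "x < 1" "0 < y" "y < 1"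
    and "(side_at V 4 x, side_at V 0 y) \<in> complete_points V"
  shows "reaches_roof 10 (side_at V 4 x, side_at V 0 y)"
  using reaches_roof_step[OF run_40[OF assms(1-4)] reaches_roof_01[OF assms(3,4) _ _ run_complete[OF run_40[OF assms(1-4)] assms(5)]]]
    mult_strict_mono[of b 1 "1 - x" 1] b_pos b_less assms by simp

text \<open>A uniform bound is needed to start an orbit a fixed time in the past and still meet the
  roof by time 0. The value 10 comes from the longest chain 40, 01, 12, 24, 41, 13, 30, 01, 12, 23,
  34.\<close>

lemma complete_reaches_roof:
  assumes p: "p \<in> complete_points V" shows "reaches_roof 10 p"
proof -
  obtain i j x y where ij: "i < 5" "j < 5" "0 < bracket (side_vec V i) (side_vec V j)"
    and xy: "0 < x" "x < 1" "0 < y" "y < 1" and eq: "p = (side_at V i x, side_at V j y)"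
    using phase_space_side_at[OF complete_points_phase_space[OF p]] length_V by metis
  note r = reaches_roof_mono[where n = 10]
  have "(i, j) \<in> {(0,1), (1,2), (2,3), (3,4), (4,0), (3,0), (1,3), (4,1), (2,4)}"
    using ij(3) b_pos b_less ab_facts(1) ij(1,2)[unfolded less_5]
    by (elim disjE; simp add: side_vec_V bracket_def algebra_simps)
  then show ?thesis
    using p unfolding eq
    by (elim insertE)
      (simp_all add: r[OF reaches_roof_01[OF xy, simplified]] r[OF reaches_roof_12[OF xy, simplified]] r[OF reaches_roof_23[OF xy, simplified]]
        r[OF reaches_roof_34[OF xy, simplified]] r[OF reaches_roof_40[OF xy, simplified]] r[OF reaches_roof_30[OF xy, simplified]]
        r[OF reaches_roof_13[OF xy, simplified]] r[OF reaches_roof_41[OF xy, simplified]] r[OF reaches_roof_24[OF xy, simplified]])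
qed

end

section \<open>Tile orbits of the Penthouse\<close>

text \<open>Lagrange's identity; it makes Cauchy-Schwarz strict for vectors with nonzero
  bracket.\<close>

lemma norm_bracket: "(norm u * norm v)\<^sup>2 = (u \<bullet> v)\<^sup>2 + (bracket u v)\<^sup>2"
  unfolding power_mult_distrib power2_norm_eq_inner
  by (simp add: bracket_def inner_prod_def power2_eq_square algebra_simps)

lemma sin_vec_angle_pos:
  assumes "0 < bracket u v" shows "0 < sin (vec_angle u v)"
proof -
  define c where "c = u \<bullet> v / (norm u * norm v)"
  have "(u \<bullet> v)\<^sup>2 < (norm u * norm v)\<^sup>2"
    using assms unfolding norm_bracket by simp
  then have "c\<^sup>2 < 1"
    unfolding c_def power_divide by (subst divide_less_eq_1_pos) (auto simp: zero_less_power2)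
  then have "\<bar>c\<bar> < 1" by (simp add: abs_square_less_1)
  then show ?thesis
    using \<open>c\<^sup>2 < 1\<close> unfolding vec_angle_def c_def[symmetric] by (simp add: sin_arccos)
qed

section \<open>Finite checks on words\<close>

definition least_rotation :: "nat list \<Rightarrow> nat \<Rightarrow> bool"
  where "least_rotation ws n \<longleftrightarrow> 1 \<le> n \<and> rotate n ws = ws \<and> (\<forall>j\<in>{1..<n}. rotate j ws \<noteq> ws)"

definition rotations :: "nat list \<Rightarrow> nat list list"
  where "rotations ws = map (\<lambda>k. rotate k ws) [0..<length ws]"

lemma length_words [simp]: "length word_left = 7" "length word_right = 7" "length word_roof = 3"
  by (simp_all add: word_left_def word_right_def word_roof_def)

lemma words_distinct: "word_left \<noteq> word_right" "word_left \<noteq> word_roof" "word_right \<noteq> word_roof"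
  by (simp_all add: word_left_def word_right_def word_roof_def)

text \<open>The order of the pieces follows the section map, whose successive first coordinates are
  \<open>r\<close>, \<open>t\<close>, \<open>h r\<close>, \<open>h t\<close>;
  \<open>\<kappa>\<close> belongs to \<open>r\<close> and \<open>\<kappa>'\<close> to
  \<open>t\<close>.\<close>

definition pair_word :: "'a list \<times> 'a list \<Rightarrow> 'a list \<times> 'a list \<Rightarrow> 'a list"
  where "pair_word \<kappa> \<kappa>' = fst \<kappa> @ fst \<kappa>' @ snd \<kappa> @ snd \<kappa>'"

text \<open>The constant pairs occur for both long words, since b decides which of them is the
  middle one.\<close>

lemma least_rotations:
  "least_rotation (pair_word (word_left, word_right) (word_left, word_right)) 28"
  "least_rotation (pair_word (word_right, word_right) (word_left, word_right)) 28"
  "least_rotation (pair_word (word_left, word_left) (word_left, word_right)) 28"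
  "least_rotation (pair_word (word_right, word_right) (word_right, word_right)) 7"
  "least_rotation (pair_word (word_left, word_left) (word_left, word_left)) 7"
  "least_rotation (pair_word (word_roof, word_roof) (word_roof, word_roof)) 3"
  "least_rotation (pair_word (word_roof, word_roof) (word_left, word_right)) 20"
  "least_rotation (pair_word (word_roof, word_roof) (word_left, word_left)) 10"
  "least_rotation (pair_word (word_roof, word_roof) (word_right, word_right)) 10"
  by code_simp+

lemma not_rotations:
  "pair_word (word_left, word_right) (word_left, word_right) \<notin>
    set (rotations (pair_word (word_right, word_right) (word_left, word_right)))"
  "pair_word (word_left, word_right) (word_left, word_right) \<notin>
    set (rotations (pair_word (word_left, word_left) (word_left, word_right)))"
  "pair_word (word_left, word_right) (word_left, word_right) \<notin>
    set (rotations (pair_word (word_right, word_right) (word_right, word_right)))"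
  "pair_word (word_left, word_right) (word_left, word_right) \<notin>
    set (rotations (pair_word (word_left, word_left) (word_left, word_left)))"
  "pair_word (word_right, word_right) (word_left, word_right) \<notin>
    set (rotations (pair_word (word_right, word_right) (word_right, word_right)))"
  "pair_word (word_left, word_left) (word_left, word_right) \<notin>
    set (rotations (pair_word (word_left, word_left) (word_left, word_left)))"
  by code_simp+

context convex_polygon
begin

lemma periodic_word_rotate:
  assumes "ws \<noteq> []"
  shows "periodic_word (rotate n ws) = shift (periodic_word ws) (int n)"
proof
  fix k
  let ?L = "length ws"
  have less: "nat (k mod int ?L) < ?L" using assms by (simp add: nat_less_iff)
  have "int ((n + nat (k mod int ?L)) mod ?L) = (int n + k mod int ?L) mod int ?L"
    using assms by (simp add: zmod_int)
  also have "\<dots> = (k + int n) mod int ?L" by (simp add: mod_add_right_eq add.commute)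
  finally have "(n + nat (k mod int ?L)) mod ?L = nat ((k + int n) mod int ?L)" by linarith
  then show "periodic_word (rotate n ws) k = shift (periodic_word ws) (int n) k"
    using less by (simp add: periodic_word_def shift_def nth_rotate)
qed

lemma periodic_word_inject:
  assumes "periodic_word ws = periodic_word vs" "length ws = length vs"
  shows "ws = vs"
proof (rule nth_equalityI)
  fix i assume "i < length ws"
  then show "ws ! i = vs ! i"
    using fun_cong[OF assms(1), of "int i"] assms(2) by (simp add: periodic_word_def)
qed (rule assms(2))

lemma least_period_word:
  assumes "least_rotation ws n" "ws \<noteq> []"
  shows "least_period (periodic_word ws) n"
  using assms(1) periodic_word_inject[of "rotate _ ws" ws]
  unfolding least_period_def least_rotation_def periodic_word_rotate[OF assms(2), symmetric]
  by auto

lemma shift_periodic_word: "shift (periodic_word ws) (int (length ws)) = periodic_word ws"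
  by (rule ext) (simp add: shift_def periodic_word_def)

text \<open>Only the residue of a shift modulo the length matters, which turns the infinite shift
  class into a finite list that can be searched by evaluation.\<close>

lemma shift_class_eq_rotation:
  assumes "shift_class (periodic_word ws) = shift_class (periodic_word vs)"
    and "length ws = length vs" "vs \<noteq> []"
  shows "ws \<in> set (rotations vs)"
proof -
  let ?L = "int (length vs)"
  have "periodic_word ws \<in> shift_class (periodic_word ws)"
    unfolding shift_class_eq by (rule image_eqI[of _ _ 0]) simp_all
  then have "periodic_word ws \<in> shift_class (periodic_word vs)" using assms(1) by (rule subst[rotated])
  then obtain d where d: "periodic_word ws = shift (periodic_word vs) d"
    unfolding shift_class_eq by blast
  define n where "n = nat (d mod ?L)"
  have n: "int n = d mod ?L" "n < length vs" using assms(3) by (auto simp: n_def nat_less_iff)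
  have "shift (periodic_word vs) d = shift (periodic_word vs) (int n)"
    unfolding shift_def periodic_word_def n(1) by (simp add: mod_add_right_eq)
  then have "periodic_word ws = periodic_word (rotate n vs)"
    using d periodic_word_rotate[OF assms(3)] by simp
  then have "ws = rotate n vs" using periodic_word_inject assms(2) by simp
  then show ?thesis using n(2) by (auto simp: rotations_def)
qed

text \<open>\<open>tile_orbit\<close> iterates forwards only; periodicity undoes the shift by
  \<open>n\<close> through a further shift by \<open>m * n - n\<close>.\<close>

lemma tile_orbit_shift:
  assumes "shift \<sigma> (int m) = \<sigma>" "0 < m"
  shows "tile_orbit V (tile V (shift \<sigma> (int n))) = tile_orbit V (tile V \<sigma>)"
proof -
  have mult: "shift \<sigma> (int (m * k)) = \<sigma>" for k
  proof (induction k)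
    case (Suc k)
    have "shift \<sigma> (int (m * Suc k)) = shift (shift \<sigma> (int m)) (int (m * k))"
      by (simp add: algebra_simps)
    then show ?case using Suc assms(1) by simp
  qed simp
  have shifted: "\<exists>j. shift \<sigma> (int k) = shift \<sigma> (int n + int j)" for k
  proof -
    have "shift \<sigma> (int k) = shift (shift \<sigma> (int (m * n))) (int k)" using mult by simp
    also have "\<dots> = shift \<sigma> (int n + int (m * n - n + k))"
    proof -
      have "n \<le> m * n" using assms(2) by simp
      then have "int (m * n) + int k = int n + int (m * n - n + k)" by linarith
      then show ?thesis by (simp only: shift_shift)
    qed
    finally show ?thesis by blast
  qed
  show ?thesis
    unfolding tile_orbit_eq shift_shift
  proof (intro subset_antisym subsetI)
    fix M assume "M \<in> {tile V (shift \<sigma> (int n + int k)) | k. True}"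
    then obtain k where "M = tile V (shift \<sigma> (int (n + k)))" by auto
    then show "M \<in> {tile V (shift \<sigma> (int k)) | k. True}" by blast
  next
    fix M assume "M \<in> {tile V (shift \<sigma> (int k)) | k. True}"
    then obtain k where "M = tile V (shift \<sigma> (int k))" by blast
    then show "M \<in> {tile V (shift \<sigma> (int n + int k)) | k. True}" using shifted[of k] by auto
  qed
qed

end

context periodic_billiard
begin

lemma tile_orbit_shift_class:
  assumes "p \<in> tile V \<sigma>" "tile_orbit V (tile V \<sigma>) = tile_orbit V (tile V \<tau>)"
  shows "shift_class \<sigma> = shift_class \<tau>"
proof -
  have "tile V \<sigma> \<in> tile_orbit V (tile V \<sigma>)"
    unfolding tile_orbit_def by (auto intro: exI[of _ 0])
  then have "tile V \<sigma> \<in> tile_orbit V (tile V \<tau>)" using assms(2) by (rule subst[rotated])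
  then obtain n where "tile V \<sigma> = tile V (shift \<tau> (int n))"
    unfolding tile_orbit_eq by blast
  then show ?thesis using tile_inject[OF assms(1)] shift_class_shift by metis
qed

end

section \<open>Regular parameters and their kinds\<close>

context penthouse_billiard
begin

text \<open>Describes both coordinates of complete roof chords; the clause on \<open>h r\<close>
  makes the condition invariant under \<open>h\<close>.\<close>

definition regular :: "real \<Rightarrow> bool"
  where "regular r \<longleftrightarrow> 0 < r \<and> r < 1 \<and> r \<noteq> \<alpha> \<and> r \<noteq> \<delta> \<and> h r \<noteq> \<alpha>"

definition kind :: "real \<Rightarrow> nat list \<times> nat list"
  where "kind r = (return_word r, return_word (h r))"

text \<open>The word shared by \<open>r\<close> and \<open>h r\<close> between \<alpha> and \<beta>:
  such \<open>r\<close> lie to the right of \<alpha> if \<alpha> < \<beta> and to the left if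
  \<beta> < \<alpha>. For b = 1/2 the interval is empty and the value a dummy.\<close>

definition word_mid :: "nat list"
  where "word_mid = (if b < 1/2 then word_right else word_left)"

abbreviation "kind_side \<equiv> (word_left, word_right)"
abbreviation "kind_mid \<equiv> (word_mid, word_mid)"
abbreviation "kind_roof \<equiv> (word_roof, word_roof)"

text \<open>The case distinctions drop kinds without parameters: \<alpha> = \<beta> for b = 1/2, and
  \<delta> = 1 for a = 1.\<close>

definition kinds :: "(nat list \<times> nat list) set"
  where "kinds = {kind_side, prod.swap kind_side} \<union> (if b = 1/2 then {} else {kind_mid}) \<union>
    (if a = 1 then {} else {kind_roof})"

definition orbit_word :: "nat list \<times> nat list \<Rightarrow> nat list \<times> nat list \<Rightarrow> int \<Rightarrow> nat"
  where "orbit_word \<kappa> \<kappa>' = periodic_word (pair_word \<kappa> \<kappa>')"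

lemma regular_h: "regular r \<Longrightarrow> regular (h r)" and h_h: "regular r \<Longrightarrow> h (h r) = r"
  using h_bounds[of r] by (auto simp: regular_def)

lemma run_regular:
  "regular r \<Longrightarrow> regular t \<Longrightarrow> run (return_word r) (roof_chord r t) (roof_chord t (h r))"
  using run_return[of r t] by (simp add: regular_def)

lemma run_pair_word:
  assumes "regular r" "regular t"
  shows "run (pair_word (kind r) (kind t)) (roof_chord r t) (roof_chord r t)"
proof -
  note 1 = run_regular[OF assms] and 2 = run_regular[OF assms(2) regular_h[OF assms(1)]]
  note 3 = run_regular[OF assms[THEN regular_h]] and 4 = run_regular[OF regular_h[OF assms(2)] assms(1)]
  have "h (h r) = r" "h (h t) = t" using assms h_h by auto
  then show ?thesis
    unfolding pair_word_def kind_def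
    using run_append[OF 1 run_append[OF 2 run_append[OF 3]]] 4 by simp
qed

lemma funpow_half:
  assumes "regular r" "regular t"
  shows "(T ^^ (length (return_word r) + length (return_word t))) (roof_chord r t) =
    roof_chord (h r) (h t)"
  using run_funpow[OF run_append[OF run_regular[OF assms] run_regular[OF assms(2) regular_h[OF assms(1)]]]]
  by simp

lemma symbolic_roof_chord:
  assumes "regular r" "regular t"
  shows "symbolic_orbit V (roof_chord r t) (orbit_word (kind r) (kind t))"
proof -
  have "pair_word (kind r) (kind t) \<noteq> []"
    by (simp add: pair_word_def kind_def return_word_def word_left_def word_right_def word_roof_def)
  then show ?thesis
    unfolding orbit_word_def using symbolic_orbit_run[OF run_pair_word[OF assms]] by blast
qed

text \<open>Consecutive returns present \<open>r\<close>, \<open>t\<close>, \<open>h r\<close> and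
  \<open>h t\<close> as first coordinates, and \<open>roof_complete\<close> applies to each of the
  four chords.\<close>

lemma roof_chord_regular:
  assumes p: "roof_chord r t \<in> complete_points V" and "0 < r" "r < 1" "0 < t" "t < 1"
  shows "regular r" "regular t"
proof -
  have r: "r \<noteq> \<alpha>" "r \<noteq> \<delta>" using roof_complete[OF assms] by auto
  have step: "roof_chord t' (h r') \<in> complete_points V"
    if "roof_chord r' t' \<in> complete_points V" "0 < r'" "r' < 1" "r' \<noteq> \<alpha>" "r' \<noteq> \<delta>" "0 < t'" "t' < 1"
    for r' t'
    using run_funpow[OF run_return[OF that(2-7)]] complete_points_funpow[OF that(1)] by metis
  have p1: "roof_chord t (h r) \<in> complete_points V" using step p r assms by blast
  have hr: "0 < h r" "h r < 1" using h_bounds r assms by auto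
  have t: "t \<noteq> \<alpha>" "t \<noteq> \<delta>" using roof_complete[OF p1] assms hr by auto
  have p2: "roof_chord (h r) (h t) \<in> complete_points V" using step p1 t assms hr by blast
  have ht: "0 < h t" "h t < 1" using h_bounds t assms by auto
  have hr2: "h r \<noteq> \<alpha>" "h r \<noteq> \<delta>" using roof_complete[OF p2] hr ht by auto
  have "roof_chord (h t) (h (h r)) \<in> complete_points V" using step p2 hr hr2 ht by blast
  then have "h t \<noteq> \<alpha>" using roof_complete ht h_bounds hr hr2 by blast
  then show "regular r" "regular t" using r t hr2 assms by (auto simp: regular_def)
qed

lemma complete_from_roof:
  assumes p: "p \<in> complete_points V"
  obtains n r t where "regular r" "regular t" "p = (T ^^ n) (roof_chord r t)"
proof -
  obtain \<omega> where w: "is_orbit V \<omega>" "\<omega> 0 = p" using p by (auto simp: complete_points_def)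
  \<comment> \<open>Starting ten steps before \<open>p\<close> places the roof chord at a time \<le>
    0, so \<open>p\<close> is one of its forward iterates.\<close>
  obtain m r t where m: "m \<le> 10" "0 < r" "r < 1" "0 < t" "t < 1"
      "(T ^^ m) (\<omega> (- 10)) = roof_chord r t"
    using complete_reaches_roof[OF complete_points_orbit[OF w(1), of "- 10"]]
    unfolding reaches_roof_def by blast
  have q: "roof_chord r t = \<omega> (int m - 10)"
    using is_orbit_funpow[OF w(1), of m "- 10"] m(6) by simp
  then have "roof_chord r t \<in> complete_points V" using complete_points_orbit[OF w(1)] by simp
  then have "regular r" "regular t" using roof_chord_regular m by blast+
  moreover have "p = (T ^^ (10 - m)) (roof_chord r t)"
    using is_orbit_funpow[OF w(1), of "10 - m" "int m - 10"] q m(1) w(2) by (simp add: of_nat_diff)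
  ultimately show ?thesis using that by blast
qed

text \<open>Below \<delta>, \<open>h\<close> reflects about (\<alpha> + \<beta>)/2. Two points
  exchanged by it can both lie below \<alpha> only if \<beta> < \<alpha>, and both above \<alpha>
  only if \<alpha> < \<beta>.\<close>

lemma kind_in_kinds:
  assumes "regular r" shows "kind r \<in> kinds"
proof -
  have ab: "\<alpha> < \<beta> \<longleftrightarrow> b < 1/2" "\<beta> < \<alpha> \<longleftrightarrow> 1/2 < b" "\<delta> < 1 \<longleftrightarrow> a \<noteq> 1"
    using a_ge by (auto simp: \<alpha>_def \<beta>_def \<delta>_def field_simps)
  have r: "0 < r" "r < 1" "r \<noteq> \<alpha>" "r \<noteq> \<delta>" "h r \<noteq> \<alpha>" using assms by (auto simp: regular_def)
  then consider "r < \<alpha>" | "\<alpha> < r" "r < \<delta>" | "\<delta> < r" by linarith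
  then show ?thesis
  proof cases
    case 1
    then have h: "h r = \<delta> - r" "h r < \<delta>" using greek r by (auto simp: h_def)
    show ?thesis
    proof (cases "h r < \<alpha>")
      case True
      then have "1/2 < b" using 1 h greek(3) ab(2) by linarith
      then show ?thesis using 1 True by (simp add: kind_def return_word_def kinds_def word_mid_def)
    next
      case False
      then show ?thesis using 1 h(2) by (simp add: kind_def return_word_def kinds_def)
    qed
  next
    case 2
    then have h: "h r = \<delta> - r" "h r < \<delta>" using greek r by (auto simp: h_def)
    show ?thesis
    proof (cases "h r < \<alpha>")
      case True
      then show ?thesis using 2 by (simp add: kind_def return_word_def kinds_def)
    next
      case False
      then have "b < 1/2" using 2 h r(5) greek(3) ab(1) by linarith
      then show ?thesis using 2 False h(2) by (simp add: kind_def return_word_def kinds_def word_mid_def)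
    qed
  next
    case 3
    then have "h r = 1 + \<delta> - r" "\<not> r < \<alpha>" "\<not> r < \<delta>" using greek(1-4) by (auto simp: h_def)
    moreover have "a \<noteq> 1" using 3 r ab(3) by linarith
    moreover have "\<not> h r < \<alpha>" "\<not> h r < \<delta>" using calculation(1) r greek(1-4) by linarith+
    ultimately show ?thesis by (simp add: kind_def return_word_def kinds_def)
  qed
qed

lemma kinds_length:
  assumes "\<kappa> \<in> kinds"
  shows "length (snd \<kappa>) = length (fst \<kappa>)" "length (fst \<kappa>) = (if \<kappa> = kind_roof then 3 else 7)"
  using assms length_words words_distinct
  by (auto simp: kinds_def word_mid_def split: if_splits)

lemma length_pair_word:
  assumes "\<kappa> \<in> kinds" "\<kappa>' \<in> kinds"
  shows "length (pair_word \<kappa> \<kappa>') \<in> {12, 20, 28}"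
    and "\<kappa> \<noteq> kind_roof \<and> \<kappa>' \<noteq> kind_roof \<Longrightarrow> length (pair_word \<kappa> \<kappa>') = 28"
    and "2 * (length (fst \<kappa>) + length (fst \<kappa>')) = length (pair_word \<kappa> \<kappa>')"
    and "pair_word \<kappa> \<kappa>' \<noteq> []"
proof -
  have "fst \<kappa> \<noteq> []" using kinds_length(2)[OF assms(1)] by (auto simp: word_roof_def split: if_splits)
  then show "length (pair_word \<kappa> \<kappa>') \<in> {12, 20, 28}"
    "\<kappa> \<noteq> kind_roof \<and> \<kappa>' \<noteq> kind_roof \<Longrightarrow> length (pair_word \<kappa> \<kappa>') = 28"
    "2 * (length (fst \<kappa>) + length (fst \<kappa>')) = length (pair_word \<kappa> \<kappa>')"
    "pair_word \<kappa> \<kappa>' \<noteq> []"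
    using kinds_length[OF assms(1)] kinds_length[OF assms(2)]
    by (simp_all add: pair_word_def split: if_splits)
qed

lemma complete_period:
  assumes "p \<in> complete_points V"
  obtains \<kappa> \<kappa>' where "\<kappa> \<in> kinds" "\<kappa>' \<in> kinds" "(T ^^ length (pair_word \<kappa> \<kappa>')) p = p"
proof -
  obtain n r t where p: "regular r" "regular t" "p = (T ^^ n) (roof_chord r t)"
    using complete_from_roof[OF assms] .
  have "(T ^^ length (pair_word (kind r) (kind t))) p =
      (T ^^ n) ((T ^^ length (pair_word (kind r) (kind t))) (roof_chord r t))"
    unfolding p(3) funpow_funpow by (simp add: add.commute)
  also have "\<dots> = p"
    using run_funpow[OF run_pair_word[OF p(1,2)]] p(3) by simp
  finally show ?thesis using that kind_in_kinds p by blast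
qed

text \<open>420 is the least common multiple of 12, 20 and 28.\<close>

sublocale periodic_billiard V 420
proof
  fix p assume "p \<in> complete_points V"
  then obtain \<kappa> \<kappa>' where k: "\<kappa> \<in> kinds" "\<kappa>' \<in> kinds" "(T ^^ length (pair_word \<kappa> \<kappa>')) p = p"
    by (rule complete_period)
  have "length (pair_word \<kappa> \<kappa>') dvd 420"
    using length_pair_word(1)[OF k(1,2)] by (elim insertE) simp_all
  then obtain m where "420 = length (pair_word \<kappa> \<kappa>') * m" by (rule dvdE)
  moreover have "((T ^^ length (pair_word \<kappa> \<kappa>')) ^^ m) p = p"
    using k(3) by (induction m) auto
  ultimately show "(T ^^ 420) p = p" by (simp add: funpow_mult mult.commute)
qed simp

text \<open>Used twice: nonempty intervals realise each kind, and their openness gives the tiles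
  positive area.\<close>

lemma kind_set:
  assumes "\<kappa> \<in> kinds"
  obtains l u where "0 \<le> l" "l < u" "u \<le> 1" "{r. regular r \<and> kind r = \<kappa>} = {l<..<u}"
proof -
  have ab: "\<alpha> < \<beta> \<longleftrightarrow> b < 1/2" "\<beta> < \<alpha> \<longleftrightarrow> 1/2 < b" "\<delta> < 1 \<longleftrightarrow> a \<noteq> 1" "\<alpha> < \<delta>" "\<beta> < \<delta>"
    using a_ge greek by (auto simp: \<alpha>_def \<beta>_def \<delta>_def field_simps)
  note ne = words_distinct
  note simps = regular_def kind_def word_mid_def return_word_def h_def
  consider "\<kappa> = kind_side" | "\<kappa> = prod.swap kind_side" | "\<kappa> = kind_mid" "b \<noteq> 1/2" | "\<kappa> = kind_roof" "a \<noteq> 1"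
    using assms by (auto simp: kinds_def split: if_splits)
  then show ?thesis
  proof cases
    case 1
    have "{r. regular r \<and> kind r = \<kappa>} = {0<..<min \<alpha> \<beta>}"
      using 1 ab ne ne[symmetric] greek(1-4) by (auto simp: simps split: if_splits)
    then show ?thesis using that[of 0 "min \<alpha> \<beta>"] greek(1-4) by auto
  next
    case 2
    have "{r. regular r \<and> kind r = \<kappa>} = {max \<alpha> \<beta><..<\<delta>}"
      using 2 ab ne ne[symmetric] greek(1-4) by (auto simp: simps split: if_splits)
    then show ?thesis using that[of "max \<alpha> \<beta>" \<delta>] greek(1-4) by auto
  next
    case 3
    have "{r. regular r \<and> kind r = \<kappa>} = {min \<alpha> \<beta><..<max \<alpha> \<beta>}"
      using 3 ab ne ne[symmetric] greek(1-4) by (auto simp: simps split: if_splits)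
    then show ?thesis using that[of "min \<alpha> \<beta>" "max \<alpha> \<beta>"] greek(1-4) 3 ab by auto
  next
    case 4
    have "{r. regular r \<and> kind r = \<kappa>} = {\<delta><..<1}"
      using 4 ab ne ne[symmetric] greek(1-4) by (auto simp: simps split: if_splits)
    then show ?thesis using that[of \<delta> 1] greek(1-4) ab 4 by auto
  qed
qed

text \<open>The fixed points \<delta>/2 and (1 + \<delta>)/2 of \<open>h\<close> are avoided because
  chords over them can have a smaller period, like the centre of a tile.\<close>

lemma kind_realised:
  assumes "\<kappa> \<in> kinds"
  obtains r where "regular r" "kind r = \<kappa>" "h r \<noteq> r"
proof -
  obtain l u where lu: "l < u" "{r. regular r \<and> kind r = \<kappa>} = {l<..<u}"
    using kind_set[OF assms] by metis
  have "infinite ({l<..<u} - {\<delta> / 2, (1 + \<delta>) / 2})"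
    using infinite_Ioo[OF lu(1)] by simp
  then obtain r where r: "r \<in> {l<..<u}" "r \<noteq> \<delta> / 2" "r \<noteq> (1 + \<delta>) / 2"
    using infinite_imp_nonempty by blast
  moreover have "h r \<noteq> r" using r(2,3) by (auto simp: h_def field_simps)
  ultimately show ?thesis using that lu(2) by blast
qed

end

lemma (in convex_polygon) phase_area_empty: "phase_area V {} = 0"
  by (simp add: phase_area_def)

lemma emeasure_lborel_open_pos:
  fixes S :: "'a::euclidean_space set"
  assumes "open S" "S \<noteq> {}"
  shows "emeasure lborel S \<noteq> 0"
proof
  assume "emeasure lborel S = 0"
  then have "S \<in> null_sets lebesgue"
    using assms(1) by (intro null_sets_completionI) auto
  then show False
    using open_not_negligible[OF assms] by (simp add: negligible_iff_null_sets)
qed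

lemma has_order_on_unique:
  assumes "has_order_on V M k r" "has_order_on V M k r'"
  shows "r = r'"
  using assms unfolding has_order_on_def by (cases r r' rule: linorder_cases) force+

section \<open>Area of the tiles and their symbolic sequences\<close>

context penthouse_billiard
begin

lemma roof_chord_inject: "roof_chord r t = roof_chord r' t' \<Longrightarrow> r = r'"
  using b_less by (simp add: roof_chord_def side_at_V)

text \<open>One nonzero summand suffices, that of the sides (3,4): there the tile is open and
  nonempty in arc-length coordinates.\<close>

lemma phase_area_tile_pos:
  assumes "\<kappa> \<in> kinds" "\<kappa>' \<in> kinds"
  shows "0 < phase_area V (tile V (orbit_word \<kappa> \<kappa>'))"
proof -
  let ?\<sigma> = "orbit_word \<kappa> \<kappa>'"
  define n3 where "n3 = norm (side_vec V 3)"
  define n4 where "n4 = norm (side_vec V 4)"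
  have n: "0 < n3" "0 < n4"
    unfolding n3_def n4_def using side_vec_nonzero length_V by simp_all
  \<comment> \<open>Admitting all pairs of kinds with the same sequence makes \<open>R\<close> the
    exact trace of the tile, before different pairs are known to give different sequences.\<close>
  define K where "K = {(\<kappa>1, \<kappa>2) \<in> kinds \<times> kinds. orbit_word \<kappa>1 \<kappa>2 = ?\<sigma>}"
  define R where "R = (\<Union>(\<kappa>1, \<kappa>2)\<in>K. {r. regular r \<and> kind r = \<kappa>1} \<times> {t. regular t \<and> kind t = \<kappa>2})"
  have R_iff: "(r, t) \<in> R \<longleftrightarrow> regular r \<and> regular t \<and> orbit_word (kind r) (kind t) = ?\<sigma>" for r t
  proof
    assume "regular r \<and> regular t \<and> orbit_word (kind r) (kind t) = ?\<sigma>"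
    then show "(r, t) \<in> R"
      unfolding R_def K_def using kind_in_kinds by (intro UN_I[of "(kind r, kind t)"]) simp_all
  qed (auto simp: R_def K_def)
  \<comment> \<open>Arc length on side 3 is measured from \<open>D\<close>, whereas \<open>r\<close>
    is a distance from \<open>E\<close>.\<close>
  define f where "f = (\<lambda>(s, t). (1 - s / n3, t / n4))"
  have "open {r. regular r \<and> kind r = k}" if "k \<in> kinds" for k
    using kind_set[OF that] by (metis open_greaterThanLessThan)
  then have "open R" unfolding R_def K_def by (intro open_UN) (auto intro: open_Times)
  moreover have "continuous_on UNIV f"
    unfolding f_def split_def using n by (intro continuous_intros) auto
  ultimately have openS: "open (f -` R)" by (rule open_vimage)
  have S: "f -` R = {(s, t). 0 < s \<and> s < n3 \<and> 0 < t \<and> t < n4 \<and>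
      (side_point V 3 s, side_point V 4 t) \<in> tile V ?\<sigma>}"
  proof (intro set_eqI; unfold split_paired_all)
    fix s t
    define r where "r = 1 - s / n3"
    define u where "u = t / n4"
    have eq: "(side_point V 3 s, side_point V 4 t) = roof_chord r u"
      by (simp add: side_point_def roof_chord_def side_at_def r_def u_def n3_def n4_def)
    have bounds: "0 < s \<and> s < n3 \<and> 0 < t \<and> t < n4 \<longleftrightarrow> 0 < r \<and> r < 1 \<and> 0 < u \<and> u < 1"
      using n by (auto simp: r_def u_def field_simps)
    have "(s, t) \<in> f -` R \<longleftrightarrow> regular r \<and> regular u \<and> orbit_word (kind r) (kind u) = ?\<sigma>"
      using R_iff by (simp add: f_def r_def u_def)
    also have "\<dots> \<longleftrightarrow> 0 < r \<and> r < 1 \<and> 0 < u \<and> u < 1 \<and> roof_chord r u \<in> tile V ?\<sigma>"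
    proof
      assume "regular r \<and> regular u \<and> orbit_word (kind r) (kind u) = ?\<sigma>"
      then show "0 < r \<and> r < 1 \<and> 0 < u \<and> u < 1 \<and> roof_chord r u \<in> tile V ?\<sigma>"
        using symbolic_roof_chord[of r u] by (auto simp: tile_def regular_def)
    next
      assume *: "0 < r \<and> r < 1 \<and> 0 < u \<and> u < 1 \<and> roof_chord r u \<in> tile V ?\<sigma>"
      then have so: "symbolic_orbit V (roof_chord r u) ?\<sigma>" by (simp add: tile_def)
      have reg: "regular r" "regular u"
        using roof_chord_regular[OF symbolic_orbit_complete[OF so]] * by auto
      then show "regular r \<and> regular u \<and> orbit_word (kind r) (kind u) = ?\<sigma>"
        using symbolic_orbit_unique[OF symbolic_roof_chord[OF reg] so] by simp
    qed
    finally show "(s, t) \<in> f -` R \<longleftrightarrow> (s, t) \<in> {(s, t). 0 < s \<and> s < n3 \<and> 0 < t \<and> t < n4 \<and>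
        (side_point V 3 s, side_point V 4 t) \<in> tile V ?\<sigma>}"
      using eq bounds by auto
  qed
  obtain r t where rt: "regular r" "kind r = \<kappa>" "regular t" "kind t = \<kappa>'"
    using kind_realised assms by metis
  then have "(r, t) \<in> R" using R_iff by simp
  then have "((1 - r) * n3, t * n4) \<in> f -` R"
    using n by (simp add: f_def)
  then have pos: "emeasure lborel (f -` R) \<noteq> 0"
    using emeasure_lborel_open_pos[OF openS] by blast
  have br: "0 < bracket (side_vec V 3) (side_vec V 4)"
    using a_ge by (simp add: side_vec_V bracket_def algebra_simps)
  have sin: "ennreal (sin (vec_angle (side_vec V 3) (side_vec V 4))) \<noteq> 0"
    using sin_vec_angle_pos[OF br] by simp
  have "phase_area V (tile V ?\<sigma>) \<noteq> 0"
  proof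
    assume "phase_area V (tile V ?\<sigma>) = 0"
    then have "ennreal (sin (vec_angle (side_vec V 3) (side_vec V 4))) * emeasure lborel (f -` R) = 0"
      using br length_V unfolding phase_area_def S n3_def n4_def
      by (subst (asm) sum_eq_0_iff, simp, subst (asm) sum_eq_0_iff, simp, auto simp del: mult_eq_0_iff)
    then show False using sin pos by simp
  qed
  then show ?thesis by (simp add: zero_less_iff_neq_zero)
qed

lemma orbit_word_periodic:
  assumes "\<kappa> \<in> kinds" "\<kappa>' \<in> kinds"
  shows "shift (orbit_word \<kappa> \<kappa>') (int (length (pair_word \<kappa> \<kappa>'))) = orbit_word \<kappa> \<kappa>'"
    "0 < length (pair_word \<kappa> \<kappa>')"
  using shift_periodic_word length_pair_word(4)[OF assms] by (simp_all add: orbit_word_def)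

text \<open>This is one return to the roof: the chord \<open>(t, h r)\<close> has the kinds
  \<open>\<kappa>'\<close> and \<open>prod.swap \<kappa>\<close>.\<close>

lemma orbit_word_swap:
  assumes "\<kappa> \<in> kinds" "\<kappa>' \<in> kinds"
  shows "orbit_word \<kappa>' (prod.swap \<kappa>) = shift (orbit_word \<kappa> \<kappa>') (int (length (fst \<kappa>)))"
proof -
  have "pair_word \<kappa>' (prod.swap \<kappa>) = rotate (length (fst \<kappa>)) (pair_word \<kappa> \<kappa>')"
    unfolding pair_word_def rotate_append by simp
  then show ?thesis
    unfolding orbit_word_def using periodic_word_rotate[OF length_pair_word(4)[OF assms]] by simp
qed

lemma symbolic_orbit_kinds:
  assumes "symbolic_orbit V p \<sigma>"
  obtains \<kappa> \<kappa>' n where "\<kappa> \<in> kinds" "\<kappa>' \<in> kinds" "\<sigma> = shift (orbit_word \<kappa> \<kappa>') (int n)"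
proof -
  obtain n r t where p: "regular r" "regular t" "p = (T ^^ n) (roof_chord r t)"
    using complete_from_roof[OF symbolic_orbit_complete[OF assms]] .
  have "symbolic_orbit V p (shift (orbit_word (kind r) (kind t)) (int n))"
    unfolding p(3) by (rule symbolic_orbit_shift[OF symbolic_roof_chord[OF p(1,2)]])
  then show ?thesis using that symbolic_orbit_unique[OF assms] kind_in_kinds p by blast
qed

section \<open>Classification of tile orbits and symbolic types\<close>

definition orbit_of_kinds :: "nat list \<times> nat list \<Rightarrow> nat list \<times> nat list \<Rightarrow> chord set set"
  where "orbit_of_kinds \<kappa> \<kappa>' = tile_orbit V (tile V (orbit_word \<kappa> \<kappa>'))"

lemma tile_orbits_kinds:
  "tile_orbits V = (\<lambda>(\<kappa>, \<kappa>'). orbit_of_kinds \<kappa> \<kappa>') ` (kinds \<times> kinds)"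
proof (intro subset_antisym subsetI)
  fix \<O> assume "\<O> \<in> tile_orbits V"
  then obtain \<sigma> where s: "0 < phase_area V (tile V \<sigma>)" "\<O> = tile_orbit V (tile V \<sigma>)"
    by (auto simp: tile_orbits_def tiles_def)
  \<comment> \<open>Positive area excludes the empty tile, which belongs to every sequence that no
    orbit realises.\<close>
  then have "tile V \<sigma> \<noteq> {}" by (metis phase_area_empty less_irrefl)
  then obtain p where "p \<in> tile V \<sigma>" by blast
  then have "symbolic_orbit V p \<sigma>" by (simp add: tile_def)
  then obtain \<kappa> \<kappa>' n where k: "\<kappa> \<in> kinds" "\<kappa>' \<in> kinds" "\<sigma> = shift (orbit_word \<kappa> \<kappa>') (int n)"
    by (rule symbolic_orbit_kinds)
  then have "\<O> = orbit_of_kinds \<kappa> \<kappa>'"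
    unfolding s(2) orbit_of_kinds_def by (simp add: tile_orbit_shift[OF orbit_word_periodic])
  then show "\<O> \<in> (\<lambda>(\<kappa>, \<kappa>'). orbit_of_kinds \<kappa> \<kappa>') ` (kinds \<times> kinds)" using k by auto
next
  fix \<O> assume "\<O> \<in> (\<lambda>(\<kappa>, \<kappa>'). orbit_of_kinds \<kappa> \<kappa>') ` (kinds \<times> kinds)"
  then obtain \<kappa> \<kappa>' where k: "\<kappa> \<in> kinds" "\<kappa>' \<in> kinds" "\<O> = orbit_of_kinds \<kappa> \<kappa>'" by auto
  have "orbit_word \<kappa> \<kappa>' (i + int (length (pair_word \<kappa> \<kappa>'))) = orbit_word \<kappa> \<kappa>' i" for i
    using fun_cong[OF orbit_word_periodic(1)[OF k(1,2)], of i] by (simp only: shift_def)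
  then have "\<exists>q>0. \<forall>i. orbit_word \<kappa> \<kappa>' (i + q) = orbit_word \<kappa> \<kappa>' i"
    using orbit_word_periodic(2)[OF k(1,2)] by (metis of_nat_0_less_iff)
  then have "tile V (orbit_word \<kappa> \<kappa>') \<in> tiles V"
    unfolding tiles_def using phase_area_tile_pos[OF k(1,2)] by blast
  then show "\<O> \<in> tile_orbits V" by (auto simp: tile_orbits_def k(3) orbit_of_kinds_def)
qed

lemma symbolic_orbit_types_kinds:
  "symbolic_orbit_types V = (\<lambda>(\<kappa>, \<kappa>'). shift_class (orbit_word \<kappa> \<kappa>')) ` (kinds \<times> kinds)"
proof (intro subset_antisym subsetI)
  fix S assume "S \<in> symbolic_orbit_types V"
  then obtain p \<sigma> where s: "symbolic_orbit V p \<sigma>" "S = shift_class \<sigma>"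
    by (auto simp: symbolic_orbit_types_def)
  from s(1) obtain \<kappa> \<kappa>' n where "\<kappa> \<in> kinds" "\<kappa>' \<in> kinds" "\<sigma> = shift (orbit_word \<kappa> \<kappa>') (int n)"
    by (rule symbolic_orbit_kinds)
  then show "S \<in> (\<lambda>(\<kappa>, \<kappa>'). shift_class (orbit_word \<kappa> \<kappa>')) ` (kinds \<times> kinds)"
    unfolding s(2) by (auto simp: shift_class_shift)
next
  fix S assume "S \<in> (\<lambda>(\<kappa>, \<kappa>'). shift_class (orbit_word \<kappa> \<kappa>')) ` (kinds \<times> kinds)"
  then obtain \<kappa> \<kappa>' where k: "\<kappa> \<in> kinds" "\<kappa>' \<in> kinds" "S = shift_class (orbit_word \<kappa> \<kappa>')" by auto
  obtain r t where "regular r" "kind r = \<kappa>" "regular t" "kind t = \<kappa>'"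
    using kind_realised k by metis
  then show "S \<in> symbolic_orbit_types V"
    using symbolic_roof_chord[of r t] k(3) unfolding symbolic_orbit_types_def by blast
qed

text \<open>Stated for any invariant \<open>F\<close> of the cyclic action on pairs, to serve tile
  orbits and shift classes alike. With all four kinds the sixteen pairs form orbits of sizes 4, 1,
  4, 1, 4, 2, in the order of the right-hand side; the return maps have order 4 divided by these
  sizes.\<close>

lemma image_kinds:
  assumes swap: "\<And>\<kappa> \<kappa>'. \<kappa> \<in> kinds \<Longrightarrow> \<kappa>' \<in> kinds \<Longrightarrow> F \<kappa>' (prod.swap \<kappa>) = F \<kappa> \<kappa>'"
  shows "(\<lambda>(\<kappa>, \<kappa>'). F \<kappa> \<kappa>') ` (kinds \<times> kinds) = {F kind_side kind_side} \<union>
    (if b = 1/2 then {} else {F kind_mid kind_mid, F kind_mid kind_side}) \<union>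
    (if a = 1 then {} else {F kind_roof kind_roof, F kind_roof kind_side}) \<union>
    (if a = 1 \<or> b = 1/2 then {} else {F kind_roof kind_mid})"
proof -
  let ?A = kind_side and ?B = "(word_right, word_left)" and ?M = kind_mid and ?C = kind_roof
  have AB: "?A \<in> kinds" "?B \<in> kinds" by (simp_all add: kinds_def)
  have 1: "F ?A ?B = F ?A ?A" "F ?B ?B = F ?A ?A" "F ?B ?A = F ?A ?A"
    using swap[OF AB(1,1)] swap[OF AB(1,2)] swap[OF AB(2,2)] by simp_all
  have 2: "F ?A k = F k ?A" "F k ?B = F k ?A" "F ?B k = F k ?A" if "k \<in> kinds" "prod.swap k = k" for k
    using swap[OF that(1) AB(1)] swap[OF that(1) AB(2)] swap[OF AB(1) that(1)] that(2) by simp_all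
  have M: "?M \<in> kinds" if "b \<noteq> 1/2" using that by (simp add: kinds_def)
  have C: "?C \<in> kinds" if "a \<noteq> 1" using that by (simp add: kinds_def)
  have 3: "F ?M ?C = F ?C ?M" if "b \<noteq> 1/2" "a \<noteq> 1"
    using swap[OF C[OF that(2)] M[OF that(1)]] by simp
  show ?thesis
  proof (cases "b = 1/2"; cases "a = 1")
    assume ab: "b = 1/2" "a = 1"
    then have K: "kinds = {?A, ?B}" unfolding kinds_def by auto
    show ?thesis unfolding K using ab 1 by auto
  next
    assume ab: "b = 1/2" "a \<noteq> 1"
    then have K: "kinds = {?A, ?B, ?C}" unfolding kinds_def by auto
    show ?thesis unfolding K using ab 1 2[OF C] by auto
  next
    assume ab: "b \<noteq> 1/2" "a = 1"
    then have K: "kinds = {?A, ?B, ?M}" unfolding kinds_def by auto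
    show ?thesis unfolding K using ab 1 2[OF M] by auto
  next
    assume ab: "b \<noteq> 1/2" "a \<noteq> 1"
    then have K: "kinds = {?A, ?B, ?M, ?C}" unfolding kinds_def by auto
    show ?thesis unfolding K using ab 1 2[OF M] 2[OF C] 3 by auto
  qed
qed

lemma tile_orbits_eq:
  "tile_orbits V = {orbit_of_kinds kind_side kind_side} \<union>
    (if b = 1/2 then {} else {orbit_of_kinds kind_mid kind_mid, orbit_of_kinds kind_mid kind_side}) \<union>
    (if a = 1 then {} else {orbit_of_kinds kind_roof kind_roof, orbit_of_kinds kind_roof kind_side}) \<union>
    (if a = 1 \<or> b = 1/2 then {} else {orbit_of_kinds kind_roof kind_mid})"
  unfolding tile_orbits_kinds
proof (rule image_kinds)
  fix \<kappa> \<kappa>' assume "\<kappa> \<in> kinds" "\<kappa>' \<in> kinds"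
  then show "orbit_of_kinds \<kappa>' (prod.swap \<kappa>) = orbit_of_kinds \<kappa> \<kappa>'"
    unfolding orbit_of_kinds_def by (simp add: orbit_word_swap tile_orbit_shift[OF orbit_word_periodic])
qed

lemma symbolic_orbit_types_eq:
  "symbolic_orbit_types V = {shift_class (orbit_word kind_side kind_side)} \<union>
    (if b = 1/2 then {} else {shift_class (orbit_word kind_mid kind_mid), shift_class (orbit_word kind_mid kind_side)}) \<union>
    (if a = 1 then {} else {shift_class (orbit_word kind_roof kind_roof), shift_class (orbit_word kind_roof kind_side)}) \<union>
    (if a = 1 \<or> b = 1/2 then {} else {shift_class (orbit_word kind_roof kind_mid)})"
  unfolding symbolic_orbit_types_kinds
  by (rule image_kinds) (simp add: orbit_word_swap shift_class_shift)

text \<open>Half of the full period \<open>n * k\<close> leads to \<open>(h r, h t)\<close>, which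
  differs from \<open>(r, t)\<close> as \<open>h r \<noteq> r\<close>. For \<open>k = 2\<close> and
  \<open>k = 4\<close>, either \<open>n * j\<close> or its double is half the period, up to a full
  period.\<close>

lemma roof_order:
  assumes "regular r" "regular t" "h r \<noteq> r"
    and L: "n * k = length (pair_word (kind r) (kind t))" and k: "k \<in> {1, 2, 4}"
    and j: "1 \<le> j" "j < k"
  shows "(T ^^ (n * j)) (roof_chord r t) \<noteq> roof_chord r t"
proof
  let ?q = "roof_chord r t"
  assume eq: "(T ^^ (n * j)) ?q = ?q"
  define m where "m = length (return_word r) + length (return_word t)"
  have half: "(T ^^ m) ?q \<noteq> ?q"
    unfolding m_def funpow_half[OF assms(1,2)] using roof_chord_inject assms(3) by blast
  have mL: "2 * m = n * k"
    using length_pair_word(3)[of "kind r" "kind t"] kind_in_kinds assms(1,2) L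
    by (simp add: m_def kind_def)
  have L': "(T ^^ (n * k)) ?q = ?q"
    using run_funpow[OF run_pair_word[OF assms(1,2)]] L by simp
  have eq2: "(T ^^ (n * j + n * j)) ?q = ?q" using eq by (simp add: funpow_add)
  from k j consider "k = 2" "j = 1" | "k = 4" "j = 1" | "k = 4" "j = 2" | "k = 4" "j = 3"
    by fastforce
  then show False
  proof cases
    case 1
    then show False using mL eq half by simp
  next
    case 2
    then have "n * j + n * j = m" using mL by simp
    then show False using eq2 half by simp
  next
    case 3
    then have "n * j = m" using mL by simp
    then show False using eq half by simp
  next
    case 4
    then have "n * j + n * j = m + n * k" using mL by simp
    then have "(T ^^ m) ((T ^^ (n * k)) ?q) = ?q" using eq2 by (simp add: funpow_add)
    then show False using L' half by simp
  qed
qed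

section \<open>Return times, orders and periods\<close>

lemma least_period_orbit_word:
  assumes "least_rotation (pair_word \<kappa> \<kappa>') n" "\<kappa> \<in> kinds" "\<kappa>' \<in> kinds"
  shows "least_period (orbit_word \<kappa> \<kappa>') n"
  unfolding orbit_word_def using least_period_word[OF assms(1) length_pair_word(4)[OF assms(2,3)]] .

text \<open>Each point of the tile has one of the periods 12, 20, 28, and \<open>n\<close> divides
  it; by \<open>only\<close> this leaves the single value \<open>n * r\<close>. As an equivalence,
  the statement also keeps the types apart.\<close>

lemma orbit_in_type:
  assumes k: "\<kappa> \<in> kinds" "\<kappa>' \<in> kinds" and rot: "least_rotation (pair_word \<kappa> \<kappa>') n"
    and L: "n * r = length (pair_word \<kappa> \<kappa>')" and r: "r \<in> {1, 2, 4}"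
    and only: "\<And>N. N \<in> {12, 20, 28} \<Longrightarrow> n dvd N \<Longrightarrow> N = n * r"
  shows "orbit_of_kinds \<kappa> \<kappa>' \<in> tile_orbits_of_type V n' r' \<longleftrightarrow> n' = n \<and> r' = r"
proof -
  note lp = least_period_orbit_word[OF rot k]
  obtain x where x: "regular x" "kind x = \<kappa>" "h x \<noteq> x" using kind_realised[OF k(1)] .
  obtain y where y: "regular y" "kind y = \<kappa>'" using kind_realised[OF k(2)] .
  have q: "roof_chord x y \<in> tile V (orbit_word \<kappa> \<kappa>')"
    using symbolic_roof_chord[OF x(1) y(1)] x y by (simp add: tile_def)
  have per: "(T ^^ (n * r)) p = p" if "p \<in> tile V (orbit_word \<kappa> \<kappa>')" for p
  proof -
    have "p \<in> complete_points V" using that symbolic_orbit_complete by (auto simp: tile_def)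
    then obtain \<kappa>1 \<kappa>2 where "\<kappa>1 \<in> kinds" "\<kappa>2 \<in> kinds" "(T ^^ length (pair_word \<kappa>1 \<kappa>2)) p = p"
      by (rule complete_period)
    then show ?thesis
      using only[OF length_pair_word(1)] period_dvd[OF lp that] by metis
  qed
  have ord: "(T ^^ (n * j)) (roof_chord x y) \<noteq> roof_chord x y" if "1 \<le> j" "j < r" for j
    using roof_order[OF x(1) y(1) x(3) _ r that] L x y by simp
  have "1 \<le> r" using r by auto
  have M: "has_return_time V M n \<and> has_order_on V M n r" if "M \<in> orbit_of_kinds \<kappa> \<kappa>'" for M
    using tile_orbit_member[OF lp \<open>1 \<le> r\<close> per q ord that[unfolded orbit_of_kinds_def]] by blast
  have mem: "tile V (orbit_word \<kappa> \<kappa>') \<in> orbit_of_kinds \<kappa> \<kappa>'"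
    unfolding orbit_of_kinds_def tile_orbit_def by (auto intro: exI[of _ 0])
  have orb: "orbit_of_kinds \<kappa> \<kappa>' \<in> tile_orbits V" unfolding tile_orbits_kinds using k by auto
  show ?thesis
  proof
    assume "orbit_of_kinds \<kappa> \<kappa>' \<in> tile_orbits_of_type V n' r'"
    then have "has_return_time V (tile V (orbit_word \<kappa> \<kappa>')) n'"
        "has_order_on V (tile V (orbit_word \<kappa> \<kappa>')) n' r'"
      using mem by (auto simp: tile_orbits_of_type_def)
    then show "n' = n \<and> r' = r"
      using M[OF mem] has_return_time_unique has_order_on_unique by metis
  next
    assume "n' = n \<and> r' = r"
    then show "orbit_of_kinds \<kappa> \<kappa>' \<in> tile_orbits_of_type V n' r'"
      using M orb by (auto simp: tile_orbits_of_type_def)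
  qed
qed

text \<open>Any period is a multiple \<open>n * i\<close> of the symbolic one, and
  \<open>roof_order\<close> excludes \<open>i < r\<close> off the fixed points of
  \<open>h\<close>.\<close>

lemma least_period_realised:
  assumes k: "\<kappa> \<in> kinds" "\<kappa>' \<in> kinds" and rot: "least_rotation (pair_word \<kappa> \<kappa>') n"
    and L: "n * r = length (pair_word \<kappa> \<kappa>')" and r: "r \<in> {1, 2, 4}"
  shows "\<exists>p\<in>complete_points V. has_least_period V p (n * r)"
proof -
  obtain x where x: "regular x" "kind x = \<kappa>" "h x \<noteq> x" using kind_realised[OF k(1)] .
  obtain y where y: "regular y" "kind y = \<kappa>'" using kind_realised[OF k(2)] .
  let ?q = "roof_chord x y"
  have q: "symbolic_orbit V ?q (orbit_word \<kappa> \<kappa>')" using symbolic_roof_chord[OF x(1) y(1)] x y by simp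
  have "has_period V ?q (n * r)"
    using run_funpow[OF run_pair_word[OF x(1) y(1)]] L x y orbit_word_periodic(2)[OF k]
    by (auto simp: has_period_def Suc_le_eq)
  moreover have "\<not> has_period V ?q j" if "j < n * r" for j
  proof
    assume j: "has_period V ?q j"
    then have "n dvd j"
      using period_dvd[OF least_period_orbit_word[OF rot k], of ?q j] q by (simp add: tile_def has_period_def)
    then obtain i where i: "j = n * i" by (rule dvdE)
    then have "1 \<le> i" "i < r" using j that by (auto simp: has_period_def Suc_le_eq)
    then show False
      using roof_order[OF x(1) y(1) x(3) _ r, of n i] L x y j i by (simp add: has_period_def)
  qed
  ultimately show ?thesis using symbolic_orbit_complete[OF q] by (auto simp: has_least_period_def)
qed

lemma kinds_member:
  "kind_side \<in> kinds" "b \<noteq> 1/2 \<Longrightarrow> kind_mid \<in> kinds" "a \<noteq> 1 \<Longrightarrow> kind_roof \<in> kinds"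
  by (simp_all add: kinds_def)

lemma least_rotation_mid:
  "least_rotation (pair_word kind_mid kind_mid) 7"
  "least_rotation (pair_word kind_mid kind_side) 28"
  "least_rotation (pair_word kind_roof kind_mid) 10"
  using least_rotations by (simp_all add: word_mid_def)

lemma length_pair_words:
  "length (pair_word kind_side kind_side) = 28" "length (pair_word kind_mid kind_mid) = 28"
  "length (pair_word kind_mid kind_side) = 28" "length (pair_word kind_roof kind_roof) = 12"
  "length (pair_word kind_roof kind_side) = 20" "length (pair_word kind_roof kind_mid) = 20"
  by (simp_all add: pair_word_def word_mid_def)

lemma orbit_types:
  "orbit_of_kinds kind_side kind_side \<in> tile_orbits_of_type V n r \<longleftrightarrow> n = 28 \<and> r = 1"
  "b \<noteq> 1/2 \<Longrightarrow> orbit_of_kinds kind_mid kind_mid \<in> tile_orbits_of_type V n r \<longleftrightarrow> n = 7 \<and> r = 4"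
  "b \<noteq> 1/2 \<Longrightarrow> orbit_of_kinds kind_mid kind_side \<in> tile_orbits_of_type V n r \<longleftrightarrow> n = 28 \<and> r = 1"
  "a \<noteq> 1 \<Longrightarrow> orbit_of_kinds kind_roof kind_roof \<in> tile_orbits_of_type V n r \<longleftrightarrow> n = 3 \<and> r = 4"
  "a \<noteq> 1 \<Longrightarrow> orbit_of_kinds kind_roof kind_side \<in> tile_orbits_of_type V n r \<longleftrightarrow> n = 20 \<and> r = 1"
  "a \<noteq> 1 \<Longrightarrow> b \<noteq> 1/2 \<Longrightarrow>
    orbit_of_kinds kind_roof kind_mid \<in> tile_orbits_of_type V n r \<longleftrightarrow> n = 10 \<and> r = 2"
  by (rule orbit_in_type; use kinds_member least_rotations least_rotation_mid length_pair_words in auto)+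

lemma shift_classes_distinct:
  assumes "b \<noteq> 1/2"
  shows "shift_class (orbit_word kind_side kind_side) \<noteq> shift_class (orbit_word kind_mid kind_side)"
    "shift_class (orbit_word kind_side kind_side) \<noteq> shift_class (orbit_word kind_mid kind_mid)"
    "shift_class (orbit_word kind_mid kind_side) \<noteq> shift_class (orbit_word kind_mid kind_mid)"
proof -
  have rot: "pair_word kind_side kind_side \<notin> set (rotations (pair_word kind_mid kind_side))"
    "pair_word kind_side kind_side \<notin> set (rotations (pair_word kind_mid kind_mid))"
    "pair_word kind_mid kind_side \<notin> set (rotations (pair_word kind_mid kind_mid))"
    using not_rotations by (simp_all add: word_mid_def)
  show "shift_class (orbit_word kind_side kind_side) \<noteq> shift_class (orbit_word kind_mid kind_side)"
    "shift_class (orbit_word kind_side kind_side) \<noteq> shift_class (orbit_word kind_mid kind_mid)"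
    "shift_class (orbit_word kind_mid kind_side) \<noteq> shift_class (orbit_word kind_mid kind_mid)"
    using shift_class_eq_rotation rot length_pair_word(4) kinds_member(1) kinds_member(2)[OF assms]
    unfolding orbit_word_def by (metis length_pair_words(1-3))+
qed

text \<open>Both orbits have return time 28 and order 1, so their symbolic sequences have to tell
  them apart.\<close>

lemma orbits_28_distinct:
  assumes "b \<noteq> 1/2"
  shows "orbit_of_kinds kind_side kind_side \<noteq> orbit_of_kinds kind_mid kind_side"
proof -
  obtain r where "regular r" "kind r = kind_side" using kind_realised[OF kinds_member(1)] .
  then have "roof_chord r r \<in> tile V (orbit_word kind_side kind_side)"
    using symbolic_roof_chord[of r r] by (simp add: tile_def)
  then show ?thesis
    using tile_orbit_shift_class shift_classes_distinct(1)[OF assms] unfolding orbit_of_kinds_def by blast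
qed

lemma tile_orbits_of_type_subset: "tile_orbits_of_type V n r \<subseteq> tile_orbits V"
  by (auto simp: tile_orbits_of_type_def)

lemma tile_orbits_types:
  "tile_orbits V = tile_orbits_of_type V 3 4 \<union> tile_orbits_of_type V 10 2 \<union>
    tile_orbits_of_type V 20 1 \<union> tile_orbits_of_type V 7 4 \<union> tile_orbits_of_type V 28 1"
proof (rule subset_antisym)
  show "tile_orbits V \<subseteq> tile_orbits_of_type V 3 4 \<union> tile_orbits_of_type V 10 2 \<union>
    tile_orbits_of_type V 20 1 \<union> tile_orbits_of_type V 7 4 \<union> tile_orbits_of_type V 28 1"
    unfolding tile_orbits_eq using orbit_types by auto
qed (use tile_orbits_of_type_subset in blast)

lemma tile_orbits_of_type_eq:
  "tile_orbits_of_type V n r = tile_orbits V \<inter> tile_orbits_of_type V n r"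
  using tile_orbits_of_type_subset by blast

lemma tile_orbits_of_types:
  "a \<noteq> 1 \<Longrightarrow> tile_orbits_of_type V 3 4 = {orbit_of_kinds kind_roof kind_roof}"
  "a \<noteq> 1 \<Longrightarrow> b \<noteq> 1/2 \<Longrightarrow> tile_orbits_of_type V 10 2 = {orbit_of_kinds kind_roof kind_mid}"
  "a \<noteq> 1 \<Longrightarrow> tile_orbits_of_type V 20 1 = {orbit_of_kinds kind_roof kind_side}"
  "b \<noteq> 1/2 \<Longrightarrow> tile_orbits_of_type V 7 4 = {orbit_of_kinds kind_mid kind_mid}"
  "b \<noteq> 1/2 \<Longrightarrow> tile_orbits_of_type V 28 1 =
    {orbit_of_kinds kind_side kind_side, orbit_of_kinds kind_mid kind_side}"
  by (subst tile_orbits_of_type_eq,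
      simp add: tile_orbits_eq Int_Un_distrib2 Int_insert_left orbit_types insert_commute)+

lemma complete_periods:
  assumes "p \<in> complete_points V"
  shows "\<exists>k\<in>{12, 20, 28}. has_period V p k"
proof -
  obtain \<kappa> \<kappa>' where "\<kappa> \<in> kinds" "\<kappa>' \<in> kinds" "(T ^^ length (pair_word \<kappa> \<kappa>')) p = p"
    using complete_period[OF assms] .
  then show ?thesis using length_pair_word(1)[of \<kappa> \<kappa>'] by (intro bexI) (auto simp: has_period_def)
qed

lemma complete_period_28:
  assumes "p \<in> complete_points V" "a = 1"
  shows "has_period V p 28"
proof -
  obtain \<kappa> \<kappa>' where k: "\<kappa> \<in> kinds" "\<kappa>' \<in> kinds" "(T ^^ length (pair_word \<kappa> \<kappa>')) p = p"
    using complete_period[OF assms(1)] .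
  then have "\<kappa> \<noteq> kind_roof" "\<kappa>' \<noteq> kind_roof"
    using assms(2) words_distinct unfolding kinds_def word_mid_def by (auto split: if_splits)
  then show ?thesis using length_pair_word(2)[OF k(1,2)] k(3) by (simp add: has_period_def)
qed

lemma least_periods:
  "\<exists>p\<in>complete_points V. has_least_period V p 28"
  "a \<noteq> 1 \<Longrightarrow> \<exists>p\<in>complete_points V. has_least_period V p 20"
  "a \<noteq> 1 \<Longrightarrow> \<exists>p\<in>complete_points V. has_least_period V p 12"
  using least_period_realised[of kind_side kind_side 28 1] least_period_realised[of kind_roof kind_side 20 1]
    least_period_realised[of kind_roof kind_roof 3 4] kinds_member least_rotations length_pair_words
  by simp_all

end

lemma penthouse_modulus_tall: "1 < a \<Longrightarrow> penthouse_modulus a = 1"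
  unfolding penthouse_modulus_def by (rule floor_unique) (auto simp: field_simps)

text \<open>For b = 1/2 every orbit through \<open>kind_mid\<close> disappears: types (10, 2) and
  (7, 4), one of the two orbits of type (28, 1), and two of the three symbolic types for a = 1.
  Hence the condition on b in these counts.\<close>

theorem theorem4p2:
  fixes a b :: real
  assumes "1 \<le> a" and "0 < b" and "b < 1"
  shows
    "(1 < a \<longrightarrow>
        (\<forall>p \<in> complete_points (penthouse a b). \<exists>k \<in> {12, 20, 28}. has_period (penthouse a b) p k) \<and>
        (\<forall>k \<in> {12, 20, 28}. \<exists>p \<in> complete_points (penthouse a b). has_least_period (penthouse a b) p k) \<and>
        tile_orbits (penthouse a b) =
          tile_orbits_of_type (penthouse a b) 3 4 \<union> tile_orbits_of_type (penthouse a b) 10 2 \<union>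
          tile_orbits_of_type (penthouse a b) 20 1 \<union> tile_orbits_of_type (penthouse a b) 7 4 \<union>
          tile_orbits_of_type (penthouse a b) 28 1 \<and>
        card (tile_orbits_of_type (penthouse a b) 3 4) = 1 \<and>
        (b \<noteq> 1/2 \<longrightarrow> card (tile_orbits_of_type (penthouse a b) 10 2) = 1) \<and>
        card (tile_orbits_of_type (penthouse a b) 20 1) = 1 \<and>
        (b \<noteq> 1/2 \<longrightarrow> card (tile_orbits_of_type (penthouse a b) 7 4) = 1) \<and>
        (b \<noteq> 1/2 \<longrightarrow> card (tile_orbits_of_type (penthouse a b) 28 1) = 2)) \<and>
     (a = 1 \<longrightarrow>
        penthouse_modulus a = 2 \<and> (\<forall>a'>1. penthouse_modulus a' = 1) \<and>
        (\<forall>p \<in> complete_points (penthouse a b). has_period (penthouse a b) p 28) \<and>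
        (\<exists>p \<in> complete_points (penthouse a b). has_least_period (penthouse a b) p 28) \<and>
        (b \<noteq> 1/2 \<longrightarrow> card (symbolic_orbit_types (penthouse a b)) = 3))"
proof -
  interpret penthouse_billiard a b
    by (rule penthouse_billiard.intro[OF assms])
  have modulus: "penthouse_modulus 1 = 2"
    by (simp add: penthouse_modulus_def)
  have card: "card (tile_orbits_of_type V 28 1) = 2" if "b \<noteq> 1/2"
    using tile_orbits_of_types(5)[OF that] orbits_28_distinct[OF that] by simp
  have types: "card (symbolic_orbit_types V) = 3" if "a = 1" "b \<noteq> 1/2"
  proof -
    have "symbolic_orbit_types V = {shift_class (orbit_word kind_side kind_side),
        shift_class (orbit_word kind_mid kind_side), shift_class (orbit_word kind_mid kind_mid)}"
      unfolding symbolic_orbit_types_eq using that by auto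
    then show ?thesis using shift_classes_distinct[OF that(2)] by simp
  qed
  show ?thesis
  proof (intro conjI impI)
    assume a: "1 < a"
    then have a': "a \<noteq> 1" by simp
    show "\<forall>p\<in>complete_points V. \<exists>k\<in>{12, 20, 28}. has_period V p k"
      using complete_periods by blast
    show "\<forall>k\<in>{12, 20, 28}. \<exists>p\<in>complete_points V. has_least_period V p k"
      using least_periods(1) least_periods(2,3)[OF a'] by blast
    show "tile_orbits V = tile_orbits_of_type V 3 4 \<union> tile_orbits_of_type V 10 2 \<union>
        tile_orbits_of_type V 20 1 \<union> tile_orbits_of_type V 7 4 \<union> tile_orbits_of_type V 28 1"
      by (rule tile_orbits_types)
    show "card (tile_orbits_of_type V 3 4) = 1" "card (tile_orbits_of_type V 20 1) = 1"
      using tile_orbits_of_types(1,3)[OF a'] by simp_all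
    show "card (tile_orbits_of_type V 10 2) = 1" if "b \<noteq> 1/2"
      using tile_orbits_of_types(2)[OF a' that] by simp
    show "card (tile_orbits_of_type V 7 4) = 1" if "b \<noteq> 1/2"
      using tile_orbits_of_types(4)[OF that] by simp
    show "card (tile_orbits_of_type V 28 1) = 2" if "b \<noteq> 1/2"
      by (rule card[OF that])
  next
    assume a: "a = 1"
    show "penthouse_modulus a = 2" using modulus a by simp
    show "\<forall>a'>1. penthouse_modulus a' = 1" using penthouse_modulus_tall by blast
    show "\<forall>p\<in>complete_points V. has_period V p 28" using complete_period_28[OF _ a] by blast
    show "\<exists>p\<in>complete_points V. has_least_period V p 28" by (rule least_periods(1))
    show "card (symbolic_orbit_types V) = 3" if "b \<noteq> 1/2" by (rule types[OF a that])
  qed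
qed

end
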